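(* For every cirquent $C$: $C$ is valid if and only if $C$ is provable in the system $\mathbf{CL16}$.
   Context: Cirquents. Fix an infinite set of elementary game letters $p,q,r,\dots$. A positive literal is $p$ and a negative literal is $\neg p$ for an elementary letter $p$. Fix two disjoint infinite sets $\mathbb{C}(\sqcup)$ (disjunctive clusters) and $\mathbb{C}(\sqcap)$ (conjunctive clusters) of decimal numerals. Cirquents are defined inductively: $\top$, $\bot$ and every literal are cirquents; if $A,B$ are cirquents then so are $(A)\vee(B)$, $(A)\wedge(B)$, $(A)\sqcap^c(B)$ for any conjunctive cluster $c$, and $(A)\sqcup^c(B)$ for any disjunctive cluster $c$. $\vee,\wedge$ are parallel connectives, $\sqcup^c,\sqcap^c$ choice connectives belonging to cluster $c$; a cluster $c$ occurs in a cirquent if some choice connective with superscript $c$ occurs in it. For non-letters, $\neg$ is an abbreviation: $\neg\neg A=A$, $\neg(A\wedge B)=\neg A\vee\neg B$, $\neg(A\vee B)=\neg A\wedge\neg B$, $\neg(A\sqcap^cB)=\neg A\sqcup^c\neg B$, $\neg(A\sqcup^cB)=\neg A\sqcap^c\neg B$; $A\to B$ abbreviates $\neg A\vee B$. Games and semantics. A move is a finite string; a labeled move is a move prefixed by $\top$ (the machine) or $\bot$ (the environment); a run is a finite or infinite sequence of labeled moves. LegRuns is the set of runs $\Gamma$ such that every move is $c.0$ or $c.1$ for a cluster $c$, moves $c.i$ with $c$ disjunctive are $\top$-labeled, moves $c.i$ with $c$ conjunctive are $\bot$-labeled, and for each cluster $c$ at most one move of the form $c.i$ occurs. For $\Gamma\in$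 LegRuns, a cirquent $A\sqcup^cB$ or $A\sqcap^cB$ is resolved if $\Gamma$ contains $c.0$ or $c.1$; its resolvent is then $A$ (if $c.0$) or $B$ (if $c.1$). An interpretation $^*$ assigns to each elementary letter $p$ a value $p^*\in\{\top,\bot\}$. The game $C^*$ has LegRuns as its legal runs; a legal run $\Gamma$ is won by $\top$ iff: $C=\top$; or $C$ is $p$ (resp. $\neg p$) and $p^*=\top$ (resp. $p^*=\bot$); or $C=A_0\vee A_1$ and $\Gamma$ is won in at least one $A_i$; or $C=A_0\wedge A_1$ and $\Gamma$ is won in both $A_i$; or $C=A_0\sqcup^cA_1$ is resolved and $\Gamma$ is won in its resolvent; or $C=A_0\sqcap^cA_1$ and either it is unresolved or $\Gamma$ is won in its resolvent. A run not in LegRuns is lost by the player who made the last move of its shortest illegal initial segment. An HPM is a Turing machine with an additional read-only run tape, automatically showing the current sequence of labeled moves, and the capability of making moves; the environment may make any moves at any times. An HPM $\mathcal H$ solves a game $G$ if every run generated in any interaction of $\mathcal H$ with any environment is won by $\top$. $C$ is computable under $^*$ if some HPM solves $C^*$; $C$ is valid if a single HPM solves $C^*$ for every interpretation $^*$. The system $\mathbf{CL16}$. Notation: $X[E_1,\dots,E_n]$ denotes a cirquent with fixed subcirquents $E_1,\dots,E_n$, and $X[F_1,\dots,F_n]$ denotes the result of replacing all occurrences of $E_1,\dots,E_n$ by $F_1,\dots,F_n$; in a rule the conclusion sets the context. Rules (premise(s) $\leadsto$ conclusion): Commutativity: $X[B\vee A]\leadsto X[A\vee B]$ and $X[B\wedge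 A]\leadsto X[A\wedge B]$. Associativity: $X[A\vee(B\vee C)]\leadsto X[(A\vee B)\vee C]$ and $X[A\wedge(B\wedge C)]\leadsto X[(A\wedge B)\wedge C]$. Identity: $X[A]\leadsto X[A\vee\bot]$ and $X[A]\leadsto X[A\wedge\top]$. Domination: $X[\top]\leadsto X[A\vee\top]$ and $X[\bot]\leadsto X[A\wedge\bot]$. Choosing: $X[A_1,\dots,A_n]\leadsto X[A_1\sqcup^cB_1,\dots,A_n\sqcup^cB_n]$ and $X[B_1,\dots,B_n]\leadsto X[A_1\sqcup^cB_1,\dots,A_n\sqcup^cB_n]$, where $A_1\sqcup^cB_1,\dots,A_n\sqcup^cB_n$ are all $\sqcup^c$-rooted subcirquents of the conclusion. Cleansing: $X[Y[A]\sqcap^cC]\leadsto X[Y[A\sqcap^cB]\sqcap^cC]$ and $X[C\sqcap^cY[B]]\leadsto X[C\sqcap^cY[A\sqcap^cB]]$. Distribution: $X[(A\vee C)\wedge(B\vee C)]\leadsto X[(A\wedge B)\vee C]$ and $X[(A\vee C)\sqcap^c(B\vee C)]\leadsto X[(A\sqcap^cB)\vee C]$. Trivialization: $X[\top]\leadsto X[\neg p\vee p]$ for an elementary letter $p$. Quadrilemma: $X\big[\big((A\wedge(C\sqcap^bD))\sqcap^a(B\wedge(C\sqcap^bD))\big)\sqcap^c\big(((A\sqcap^aB)\wedge C)\sqcap^b((A\sqcap^aB)\wedge D)\big)\big]\leadsto X[(A\sqcap^aB)\wedge(C\sqcap^bD)]$, where $c$ does not occur in the conclusion. Splitting (two premises):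 $A,\ B\leadsto A\sqcap^cB$, where neither $A$ nor $B$ contains the cluster $c$. A proof of $C$ is a sequence $C_1,\dots,C_n$ with $C_1=\top$, $C_n=C$, each $C_i$ ($i\ge2$) following from earlier members by a rule. *)

theory Defs
  imports Main
begin

text \<open>Elementary letters are natural numbers; cluster names are strings (decimal numerals).
  CDisj c A B is the choice disjunction with superscript c, CConj c A B the choice conjunction.\<close>

datatype cirq =
    CTop | CBot
  | Lit nat
  | NLit nat
  | Disj cirq cirq
  | Conj cirq cirq
  | CDisj string cirq cirq
  | CConj string cirq cirq

definition decimal_numeral :: "string \<Rightarrow> bool" where
  "decimal_numeral s \<longleftrightarrow> s \<noteq> [] \<and> set s \<subseteq> set ''0123456789''"

primrec clusters :: "cirq \<Rightarrow> string set" where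
  "clusters CTop = {}"
| "clusters CBot = {}"
| "clusters (Lit p) = {}"
| "clusters (NLit p) = {}"
| "clusters (Disj A B) = clusters A \<union> clusters B"
| "clusters (Conj A B) = clusters A \<union> clusters B"
| "clusters (CDisj c A B) = insert c (clusters A \<union> clusters B)"
| "clusters (CConj c A B) = insert c (clusters A \<union> clusters B)"

primrec wf_cirq :: "string set \<Rightarrow> string set \<Rightarrow> cirq \<Rightarrow> bool" where
  "wf_cirq Cd Cc CTop = True"
| "wf_cirq Cd Cc CBot = True"
| "wf_cirq Cd Cc (Lit p) = True"
| "wf_cirq Cd Cc (NLit p) = True"
| "wf_cirq Cd Cc (Disj A B) = (wf_cirq Cd Cc A \<and> wf_cirq Cd Cc B)"
| "wf_cirq Cd Cc (Conj A B) = (wf_cirq Cd Cc A \<and> wf_cirq Cd Cc B)"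
| "wf_cirq Cd Cc (CDisj c A B) = (c \<in> Cd \<and> wf_cirq Cd Cc A \<and> wf_cirq Cd Cc B)"
| "wf_cirq Cd Cc (CConj c A B) = (c \<in> Cc \<and> wf_cirq Cd Cc A \<and> wf_cirq Cd Cc B)"

datatype player = PT | PB   (* PT = machine (top), PB = environment (bot) *)

type_synonym move = string
type_synonym lmove = "player \<times> move"

definition legal_move :: "string set \<Rightarrow> string set \<Rightarrow> lmove \<Rightarrow> bool" where
  "legal_move Cd Cc lm \<longleftrightarrow> (\<exists>c i. snd lm = c @ ''.'' @ [i] \<and> i \<in> {CHR ''0'', CHR ''1''} \<and>
      ((c \<in> Cd \<and> fst lm = PT) \<or> (c \<in> Cc \<and> fst lm = PB)))"

definition move_cluster :: "move \<Rightarrow> string" where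
  "move_cluster m = takeWhile (\<lambda>x. x \<noteq> CHR ''.'') m"

definition legal_run :: "string set \<Rightarrow> string set \<Rightarrow> lmove list \<Rightarrow> bool" where
  "legal_run Cd Cc \<Gamma> \<longleftrightarrow> (\<forall>x\<in>set \<Gamma>. legal_move Cd Cc x) \<and>
     (\<forall>i j. i < j \<and> j < length \<Gamma> \<longrightarrow> move_cluster (snd (\<Gamma> ! i)) \<noteq> move_cluster (snd (\<Gamma> ! j)))"

definition illegal_last :: "string set \<Rightarrow> string set \<Rightarrow> lmove list \<Rightarrow> lmove" where
  "illegal_last Cd Cc \<Gamma> = \<Gamma> ! (LEAST n. \<not> legal_run Cd Cc (take (Suc n) \<Gamma>))"

definition chosen :: "lmove set \<Rightarrow> string \<Rightarrow> char \<Rightarrow> bool" where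
  "chosen S c i \<longleftrightarrow> (\<exists>p. (p, c @ ''.'' @ [i]) \<in> S)"

text \<open>Winning a legal run (given as the set of its labelled moves) under interpretation I
  (I p = True means p* = top).\<close>
primrec win_leg :: "(nat \<Rightarrow> bool) \<Rightarrow> lmove set \<Rightarrow> cirq \<Rightarrow> bool" where
  "win_leg I S CTop = True"
| "win_leg I S CBot = False"
| "win_leg I S (Lit p) = I p"
| "win_leg I S (NLit p) = (\<not> I p)"
| "win_leg I S (Disj A B) = (win_leg I S A \<or> win_leg I S B)"
| "win_leg I S (Conj A B) = (win_leg I S A \<and> win_leg I S B)"
| "win_leg I S (CDisj c A B) =
     ((chosen S c (CHR ''0'') \<and> win_leg I S A) \<or> (chosen S c (CHR ''1'') \<and> win_leg I S B))"
| "win_leg I S (CConj c A B) =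
     ((\<not> chosen S c (CHR ''0'') \<and> \<not> chosen S c (CHR ''1'')) \<or>
      (chosen S c (CHR ''0'') \<and> win_leg I S A) \<or> (chosen S c (CHR ''1'') \<and> win_leg I S B))"

text \<open>A (finite or infinite) run is given by the increasing sequence R of its finite
  initial segments R t; the run itself is their limit. Top wins the run in game C* iff:\<close>
definition top_wins :: "string set \<Rightarrow> string set \<Rightarrow> (nat \<Rightarrow> bool) \<Rightarrow> cirq \<Rightarrow> (nat \<Rightarrow> lmove list) \<Rightarrow> bool" where
  "top_wins Cd Cc I C R \<longleftrightarrow>
     (if (\<forall>t. legal_run Cd Cc (R t)) then win_leg I (\<Union>t. set (R t)) C
      else (\<exists>t. \<not> legal_run Cd Cc (R t) \<and> fst (illegal_last Cd Cc (R t)) = PB))"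

text \<open>Tape symbols: blank, characters, and auxiliary symbols. On the run tape the label of a
  move is written as Aux 0 (top) or Aux 1 (bot), followed by the characters of the move.\<close>
datatype sym = Blank | Ch char | Aux nat

datatype dir = DL | DR | DS

text \<open>An HPM is given by its transition function: (state, work-tape symbol, run-tape symbol)
  to (new state, symbol written on the work tape, work head move, run head move, move flag).
  The initial state is 0.  Finiteness of the range guarantees that only finitely many states and
  symbols ever matter, i.e. that the machine is a genuine finite Turing machine.\<close>
type_synonym hpm = "nat \<times> sym \<times> sym \<Rightarrow> nat \<times> sym \<times> dir \<times> dir \<times> bool"

definition is_hpm :: "hpm \<Rightarrow> bool" where
  "is_hpm \<delta> \<longleftrightarrow> finite (range \<delta>)"

fun head_move :: "dir \<Rightarrow> nat \<Rightarrow> nat" where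
  "head_move DL n = n - 1"
| "head_move DR n = Suc n"
| "head_move DS n = n"

definition enc_run :: "lmove list \<Rightarrow> sym list" where
  "enc_run \<Gamma> = concat (map (\<lambda>(p, m). (if p = PT then Aux 0 else Aux 1) # map Ch m) \<Gamma>)"

text \<open>Configuration: state, work tape, work head, run head, current run.\<close>
type_synonym config = "nat \<times> (nat \<Rightarrow> sym) \<times> nat \<times> nat \<times> lmove list"

definition tape_move :: "(nat \<Rightarrow> sym) \<Rightarrow> nat \<Rightarrow> move" where
  "tape_move w h = concat (map (\<lambda>i. case w i of Ch c \<Rightarrow> [c] | _ \<Rightarrow> []) [0..<h])"

text \<open>One clock cycle: first the environment's moves of this cycle (any finite list of
  arbitrary strings) are appended to the run; then the machine performs one step; if it
  enters the move state, the string on its work tape left of the head is appended as its move.\<close>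
definition hpm_step :: "hpm \<Rightarrow> move list \<Rightarrow> config \<Rightarrow> config" where
  "hpm_step \<delta> em cfg = (case cfg of (q, w, wh, rh, \<Gamma>) \<Rightarrow>
     let \<Gamma>1 = \<Gamma> @ map (\<lambda>m. (PB, m)) em;
         rt = enc_run \<Gamma>1;
         rs = (if rh < length rt then rt ! rh else Blank);
         (q', a, d1, d2, mv) = \<delta> (q, w wh, rs);
         w' = w(wh := a);
         wh' = head_move d1 wh;
         rh' = head_move d2 rh;
         \<Gamma>2 = (if mv then \<Gamma>1 @ [(PT, tape_move w' wh')] else \<Gamma>1)
     in (q', w', wh', rh', \<Gamma>2))"

primrec hpm_conf :: "hpm \<Rightarrow> (nat \<Rightarrow> move list) \<Rightarrow> nat \<Rightarrow> config" where
  "hpm_conf \<delta> e 0 = (0, (\<lambda>_. Blank), 0, 0, [])"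
| "hpm_conf \<delta> e (Suc t) = hpm_step \<delta> (e t) (hpm_conf \<delta> e t)"

definition gen_run :: "hpm \<Rightarrow> (nat \<Rightarrow> move list) \<Rightarrow> nat \<Rightarrow> lmove list" where
  "gen_run \<delta> e t = snd (snd (snd (snd (hpm_conf \<delta> e t))))"

definition solves :: "string set \<Rightarrow> string set \<Rightarrow> hpm \<Rightarrow> (nat \<Rightarrow> bool) \<Rightarrow> cirq \<Rightarrow> bool" where
  "solves Cd Cc \<delta> I C \<longleftrightarrow> (\<forall>e. top_wins Cd Cc I C (gen_run \<delta> e))"

definition valid :: "string set \<Rightarrow> string set \<Rightarrow> cirq \<Rightarrow> bool" where
  "valid Cd Cc C \<longleftrightarrow> (\<exists>\<delta>. is_hpm \<delta> \<and> (\<forall>I. solves Cd Cc \<delta> I C))"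

primrec subs :: "cirq \<Rightarrow> cirq set" where
  "subs CTop = {CTop}"
| "subs CBot = {CBot}"
| "subs (Lit p) = {Lit p}"
| "subs (NLit p) = {NLit p}"
| "subs (Disj A B) = insert (Disj A B) (subs A \<union> subs B)"
| "subs (Conj A B) = insert (Conj A B) (subs A \<union> subs B)"
| "subs (CDisj c A B) = insert (CDisj c A B) (subs A \<union> subs B)"
| "subs (CConj c A B) = insert (CConj c A B) (subs A \<union> subs B)"

primrec repl :: "cirq \<Rightarrow> cirq \<Rightarrow> cirq \<Rightarrow> cirq" where
  "repl E F CTop = (if CTop = E then F else CTop)"
| "repl E F CBot = (if CBot = E then F else CBot)"
| "repl E F (Lit p) = (if Lit p = E then F else Lit p)"
| "repl E F (NLit p) = (if NLit p = E then F else NLit p)"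
| "repl E F (Disj A B) = (if Disj A B = E then F else Disj (repl E F A) (repl E F B))"
| "repl E F (Conj A B) = (if Conj A B = E then F else Conj (repl E F A) (repl E F B))"
| "repl E F (CDisj c A B) = (if CDisj c A B = E then F else CDisj c (repl E F A) (repl E F B))"
| "repl E F (CConj c A B) = (if CConj c A B = E then F else CConj c (repl E F A) (repl E F B))"

primrec resolve_disj :: "string \<Rightarrow> bool \<Rightarrow> cirq \<Rightarrow> cirq" where
  "resolve_disj c b CTop = CTop"
| "resolve_disj c b CBot = CBot"
| "resolve_disj c b (Lit p) = Lit p"
| "resolve_disj c b (NLit p) = NLit p"
| "resolve_disj c b (Disj A B) = Disj (resolve_disj c b A) (resolve_disj c b B)"
| "resolve_disj c b (Conj A B) = Conj (resolve_disj c b A) (resolve_disj c b B)"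
| "resolve_disj c b (CDisj d A B) =
     (if d = c then (if b then resolve_disj c b B else resolve_disj c b A)
      else CDisj d (resolve_disj c b A) (resolve_disj c b B))"
| "resolve_disj c b (CConj d A B) = CConj d (resolve_disj c b A) (resolve_disj c b B)"

text \<open>Single-subcirquent rules: local_rule F E means X[F] leads to X[E].\<close>
inductive local_rule :: "cirq \<Rightarrow> cirq \<Rightarrow> bool" where
  comm_or: "local_rule (Disj B A) (Disj A B)"
| comm_and: "local_rule (Conj B A) (Conj A B)"
| assoc_or: "local_rule (Disj A (Disj B C)) (Disj (Disj A B) C)"
| assoc_and: "local_rule (Conj A (Conj B C)) (Conj (Conj A B) C)"
| ident_or: "local_rule A (Disj A CBot)"
| ident_and: "local_rule A (Conj A CTop)"
| dom_or: "local_rule CTop (Disj A CTop)"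
| dom_and: "local_rule CBot (Conj A CBot)"
| distr_and: "local_rule (Conj (Disj A C) (Disj B C)) (Disj (Conj A B) C)"
| distr_cand: "local_rule (CConj c (Disj A C) (Disj B C)) (Disj (CConj c A B) C)"
| trivial: "local_rule CTop (Disj (NLit p) (Lit p))"

inductive provable :: "string set \<Rightarrow> string set \<Rightarrow> cirq \<Rightarrow> bool" for Cd Cc where
  axiom: "provable Cd Cc CTop"
| local: "\<lbrakk> wf_cirq Cd Cc Z; local_rule F E; E \<in> subs Z; provable Cd Cc (repl E F Z) \<rbrakk>
           \<Longrightarrow> provable Cd Cc Z"
| choosing: "\<lbrakk> wf_cirq Cd Cc Z; CDisj c A B \<in> subs Z; provable Cd Cc (resolve_disj c b Z) \<rbrakk>
           \<Longrightarrow> provable Cd Cc Z"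
| cleansing1: "\<lbrakk> wf_cirq Cd Cc Z; CConj c Y C \<in> subs Z; CConj c A B \<in> subs Y;
                 provable Cd Cc (repl (CConj c Y C) (CConj c (repl (CConj c A B) A Y) C) Z) \<rbrakk>
           \<Longrightarrow> provable Cd Cc Z"
| cleansing2: "\<lbrakk> wf_cirq Cd Cc Z; CConj c C Y \<in> subs Z; CConj c A B \<in> subs Y;
                 provable Cd Cc (repl (CConj c C Y) (CConj c C (repl (CConj c A B) B Y)) Z) \<rbrakk>
           \<Longrightarrow> provable Cd Cc Z"
| quadrilemma: "\<lbrakk> wf_cirq Cd Cc Z; c \<in> Cc; c \<notin> clusters Z;
                  Conj (CConj a A B) (CConj b C D) \<in> subs Z;
                  provable Cd Cc (repl (Conj (CConj a A B) (CConj b C D))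
                    (CConj c
                       (CConj a (Conj A (CConj b C D)) (Conj B (CConj b C D)))
                       (CConj b (Conj (CConj a A B) C) (Conj (CConj a A B) D))) Z) \<rbrakk>
           \<Longrightarrow> provable Cd Cc Z"
| splitting: "\<lbrakk> wf_cirq Cd Cc (CConj c A B); c \<notin> clusters A; c \<notin> clusters B;
                provable Cd Cc A; provable Cd Cc B \<rbrakk>
           \<Longrightarrow> provable Cd Cc (CConj c A B)"

end

theory Submission
  imports Defs
begin

text \<open>Both directions go through the existence of a winning strategy, taken as a prefix-monotone map
  from sequences of environment choices to sets of machine choices.  If no strategy exists, then
  either some environment choice keeps it so, or the cirquent with all its choices left open is
  falsifiable; since only finitely many clusters matter, this yields an environment that beats any
  given HPM.  Conversely, a strategy is played by an HPM that scans the run tape and keeps the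
  resolved cirquent in its state.  Every rule preserves the existence of strategies from premises to
  conclusion, and all rules needed below except choosing preserve it backwards as well.  For
  completeness, a cirquent in which the machine has no useful choice to make is a tautology when its
  choices are left open.  Pulling \<open>\<and>\<close> and \<open>\<sqinter>\<close> out of \<open>\<or>\<close> and merging conjunctions by
  quadrilemma turns it into \<open>\<top>\<close> or into a \<open>\<sqinter>\<close>-rooted cirquent, to which cleansing and splitting
  apply.\<close>

section \<open>Strategies and soundness of the rules\<close>

text \<open>Two obstacles shape the proof. Distribution and the quadrilemma copy subcirquents, so
  size is no termination measure for completeness. \<open>rank\<close> is multiplicative at
  \<open>Disj\<close>, which makes distribution over \<open>Conj\<close> neutral. The factor 2 at
  \<open>Conj\<close> pays for the two choice layers that the quadrilemma lifts above the
  conjunctions: with m and n the larger ranks in the two choices, both sides have rank 2m + 2n + 4,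
  whereas a factor 1 would make the premise larger by one. On the machine side, a strategy depends
  on an unbounded history, but an HPM has a finite control. Keeping the residual cirquent winnable
  is enough, and there are finitely many residuals, so the choice to make next is a finite table.
  The environment may moreover make illegal moves of any length. The machine therefore reads through
  a truncated buffer, and what it guarantees is stated relative to legal continuations of the run,
  hence void after an illegal environment move.\<close>

primrec holds :: "(nat \<Rightarrow> bool) \<Rightarrow> (string \<Rightarrow> bool option) \<Rightarrow> (string \<Rightarrow> bool option) \<Rightarrow> cirq \<Rightarrow> bool" where
  "holds I r g CTop = True"
| "holds I r g CBot = False"
| "holds I r g (Lit p) = I p"
| "holds I r g (NLit p) = (\<not> I p)"
| "holds I r g (Disj A B) = (holds I r g A \<or> holds I r g B)"
| "holds I r g (Conj A B) = (holds I r g A \<and> holds I r g B)"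
| "holds I r g (CDisj c A B) =
     (case g c of None \<Rightarrow> False | Some b \<Rightarrow> if b then holds I r g B else holds I r g A)"
| "holds I r g (CConj c A B) =
     (case r c of None \<Rightarrow> True | Some b \<Rightarrow> if b then holds I r g B else holds I r g A)"

primrec disj_clusters :: "cirq \<Rightarrow> string set" where
  "disj_clusters CTop = {}"
| "disj_clusters CBot = {}"
| "disj_clusters (Lit p) = {}"
| "disj_clusters (NLit p) = {}"
| "disj_clusters (Disj A B) = disj_clusters A \<union> disj_clusters B"
| "disj_clusters (Conj A B) = disj_clusters A \<union> disj_clusters B"
| "disj_clusters (CDisj c A B) = insert c (disj_clusters A \<union> disj_clusters B)"
| "disj_clusters (CConj c A B) = disj_clusters A \<union> disj_clusters B"

primrec conj_clusters :: "cirq \<Rightarrow> string set" where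
  "conj_clusters CTop = {}"
| "conj_clusters CBot = {}"
| "conj_clusters (Lit p) = {}"
| "conj_clusters (NLit p) = {}"
| "conj_clusters (Disj A B) = conj_clusters A \<union> conj_clusters B"
| "conj_clusters (Conj A B) = conj_clusters A \<union> conj_clusters B"
| "conj_clusters (CDisj c A B) = conj_clusters A \<union> conj_clusters B"
| "conj_clusters (CConj c A B) = insert c (conj_clusters A \<union> conj_clusters B)"

primrec resolve_conj :: "string \<Rightarrow> bool \<Rightarrow> cirq \<Rightarrow> cirq" where
  "resolve_conj c b CTop = CTop"
| "resolve_conj c b CBot = CBot"
| "resolve_conj c b (Lit p) = Lit p"
| "resolve_conj c b (NLit p) = NLit p"
| "resolve_conj c b (Disj A B) = Disj (resolve_conj c b A) (resolve_conj c b B)"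
| "resolve_conj c b (Conj A B) = Conj (resolve_conj c b A) (resolve_conj c b B)"
| "resolve_conj c b (CDisj d A B) = CDisj d (resolve_conj c b A) (resolve_conj c b B)"
| "resolve_conj c b (CConj d A B) =
     (if d = c then (if b then resolve_conj c b B else resolve_conj c b A)
      else CConj d (resolve_conj c b A) (resolve_conj c b B))"

lemma clusters_eq: "clusters C = disj_clusters C \<union> conj_clusters C"
  by (induction C) auto

lemma finite_disj_clusters [simp]: "finite (disj_clusters C)"
  by (induction C) auto

lemma finite_conj_clusters [simp]: "finite (conj_clusters C)"
  by (induction C) auto

lemma finite_clusters [simp]: "finite (clusters C)"
  by (simp add: clusters_eq)

lemma wf_cirq_iff: "wf_cirq Cd Cc C \<longleftrightarrow> disj_clusters C \<subseteq> Cd \<and> conj_clusters C \<subseteq> Cc"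
  by (induction C) auto

lemma disj_clusters_resolve_disj:
  "disj_clusters (resolve_disj c b C) \<subseteq> disj_clusters C - {c}"
  by (induction C) auto

lemma conj_clusters_resolve_disj:
  "conj_clusters (resolve_disj c b C) \<subseteq> conj_clusters C"
  by (induction C) auto

lemma disj_clusters_resolve_conj:
  "disj_clusters (resolve_conj c b C) \<subseteq> disj_clusters C"
  by (induction C) auto

lemma conj_clusters_resolve_conj:
  "conj_clusters (resolve_conj c b C) \<subseteq> conj_clusters C - {c}"
  by (induction C) auto

lemma wf_resolve_disj: "wf_cirq Cd Cc C \<Longrightarrow> wf_cirq Cd Cc (resolve_disj c b C)"
  using disj_clusters_resolve_disj conj_clusters_resolve_disj unfolding wf_cirq_iff by blast

lemma wf_resolve_conj: "wf_cirq Cd Cc C \<Longrightarrow> wf_cirq Cd Cc (resolve_conj c b C)"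
  using disj_clusters_resolve_conj conj_clusters_resolve_conj unfolding wf_cirq_iff by blast

lemma resolve_conj_idle: "c \<notin> conj_clusters C \<Longrightarrow> resolve_conj c b C = C"
  by (induction C) auto

lemma holds_cong:
  assumes "\<And>c. c \<in> conj_clusters C \<Longrightarrow> r c = r' c" "\<And>c. c \<in> disj_clusters C \<Longrightarrow> g c = g' c"
  shows "holds I r g C = holds I r' g' C"
  using assms by (induction C) (auto split: option.split)

lemma holds_resolve_disj: "g c = Some b \<Longrightarrow> holds I r g (resolve_disj c b C) = holds I r g C"
  by (induction C) (auto split: option.split)

lemma holds_resolve_conj: "r c = Some b \<Longrightarrow> holds I r g (resolve_conj c b C) = holds I r g C"
  by (induction C) (auto split: option.split)

lemma holds_resolve_disj_upd:
  "holds I r (g(c \<mapsto> b)) (resolve_disj c b C) = holds I r g (resolve_disj c b C)"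
  using disj_clusters_resolve_disj[of c b C] by (intro holds_cong) auto

lemma holds_resolve_conj_upd:
  "holds I (r(c \<mapsto> b)) g (resolve_conj c b C) = holds I r g (resolve_conj c b C)"
  using conj_clusters_resolve_conj[of c b C] by (intro holds_cong) auto

text \<open>Negation sits only at letters and all connectives are monotone, so an implication
  between the exchanged cirquents lifts to every context.\<close>

lemma holds_repl_mono:
  assumes "holds I r g E \<Longrightarrow> holds I r g F" "holds I r g Z"
  shows "holds I r g (repl E F Z)"
  using assms(2) by (induction Z) (use assms(1) in \<open>auto split: option.splits if_splits\<close>)

lemma holds_repl_mono':
  assumes "holds I r g F \<Longrightarrow> holds I r g E" "holds I r g (repl E F Z)"
  shows "holds I r g Z"
  using assms(2) by (induction Z) (use assms(1) in \<open>auto split: option.splits if_splits\<close>)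

lemma holds_local_rule: "local_rule F E \<Longrightarrow> holds I r g F = holds I r g E"
  by (induction rule: local_rule.induct) (auto split: option.split)

lemma disj_clusters_repl: "disj_clusters (repl E F Z) \<subseteq> disj_clusters Z \<union> disj_clusters F"
  by (induction Z) auto

lemma conj_clusters_repl: "conj_clusters (repl E F Z) \<subseteq> conj_clusters Z \<union> conj_clusters F"
  by (induction Z) auto

lemma subs_refl [simp]: "C \<in> subs C"
  by (cases C) auto

lemma disj_clusters_subs: "A \<in> subs C \<Longrightarrow> disj_clusters A \<subseteq> disj_clusters C"
  by (induction C) auto

lemma conj_clusters_subs: "A \<in> subs C \<Longrightarrow> conj_clusters A \<subseteq> conj_clusters C"
  by (induction C) auto

text \<open>A strategy maps the history of the environment's choices to the machine's choices so far.
  It has to depend on the order of the environment's choices, not merely on their set: the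
  quadrilemma rule asks which of two clusters has been resolved first.\<close>

definition winnable :: "cirq \<Rightarrow> bool" where
  "winnable C \<longleftrightarrow> (\<exists>g. (\<forall>h k. g h \<subseteq>\<^sub>m g (h @ k)) \<and> (\<forall>h I. holds I (map_of h) (g h) C))"

lemma winnableI:
  assumes "\<And>h k. g h \<subseteq>\<^sub>m g (h @ k)" "\<And>h I. holds I (map_of h) (g h) C"
  shows "winnable C"
  using assms unfolding winnable_def by blast

lemma winnableE:
  assumes "winnable C"
  obtains g where "\<And>h k. g h \<subseteq>\<^sub>m g (h @ k)" "\<And>h I. holds I (map_of h) (g h) C"
  using assms unfolding winnable_def by blast

lemma winnable_mono:
  assumes "winnable C" "\<And>I r g. holds I r g C \<Longrightarrow> holds I r g D"
  shows "winnable D"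
  using assms unfolding winnable_def by blast

section \<open>Strategies under resolution and splitting\<close>

text \<open>The choice \<open>d \<mapsto> b\<close> is added to the answer to every history, the
  empty one included.\<close>

lemma winnable_resolve_disjD:
  assumes "winnable (resolve_disj d b C)" shows "winnable C"
proof -
  obtain g where g: "\<And>h k. g h \<subseteq>\<^sub>m g (h @ k)" "\<And>h I. holds I (map_of h) (g h) (resolve_disj d b C)"
    using assms by (rule winnableE) blast
  show ?thesis
  proof (rule winnableI)
    show "(g h)(d \<mapsto> b) \<subseteq>\<^sub>m (g (h @ k))(d \<mapsto> b)" for h k
      using g(1)[of h k] by (simp add: map_le_def)
    have "holds I (map_of h) ((g h)(d \<mapsto> b)) (resolve_disj d b C)" for h I
      using g(2)[of I h] by (simp add: holds_resolve_disj_upd)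
    then show "holds I (map_of h) ((g h)(d \<mapsto> b)) C" for h I
      by (simp add: holds_resolve_disj)
  qed
qed

text \<open>Play as if \<open>(c, b)\<close> had been the environment's very first choice. It goes
  to the front because \<open>map_of\<close> lets the earliest entry decide.\<close>

lemma winnable_resolve_conj:
  assumes "winnable C" shows "winnable (resolve_conj c b C)"
proof -
  obtain g where g: "\<And>h k. g h \<subseteq>\<^sub>m g (h @ k)" "\<And>h I. holds I (map_of h) (g h) C"
    using assms by (rule winnableE) blast
  show ?thesis
  proof (rule winnableI)
    show "g ((c, b) # h) \<subseteq>\<^sub>m g ((c, b) # h @ k)" for h k
      using g(1)[of "(c, b) # h" k] by simp
    have "holds I (map_of ((c, b) # h)) (g ((c, b) # h)) (resolve_conj c b C)" for h I
      using g(2)[of I "(c, b) # h"] by (simp add: holds_resolve_conj)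
    then show "holds I (map_of h) (g ((c, b) # h)) (resolve_conj c b C)" for h I
      by (simp add: holds_resolve_conj_upd)
  qed
qed

text \<open>Inspect the answer to the empty history. By monotonicity a choice made there is made for
  all histories and can be built into the cirquent; if it touches no cluster of \<open>C\<close>,
  then \<open>C\<close> is won with everything open.\<close>

lemma winnable_cases:
  assumes "winnable C"
  shows "(\<exists>d\<in>disj_clusters C. \<exists>b. winnable (resolve_disj d b C)) \<or> (\<forall>I. holds I Map.empty Map.empty C)"
proof -
  obtain g where g: "\<And>h k. g h \<subseteq>\<^sub>m g (h @ k)" "\<And>h I. holds I (map_of h) (g h) C"
    using assms by (rule winnableE) blast
  show ?thesis
  proof (cases "\<exists>d\<in>disj_clusters C. g [] d \<noteq> None")
    case True
    then obtain d b where d: "d \<in> disj_clusters C" "g [] d = Some b" by auto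
    have "g h d = Some b" for h
      using g(1)[of "[]" h] d(2) by (auto simp: map_le_def dom_def)
    then have "winnable (resolve_disj d b C)"
      using g by (intro winnableI[of g]) (auto simp: holds_resolve_disj)
    with d show ?thesis by blast
  next
    case False
    then have "holds I Map.empty Map.empty C" for I
      using g(2)[of I "[]"] holds_cong[of C Map.empty Map.empty "g []" Map.empty I] by auto
    then show ?thesis by blast
  qed
qed

text \<open>Stay idle until the environment first resolves a cluster of \<open>C\<close>, then
  follow the strategy for what remains. Choices in other clusters are filtered out, since they do
  not affect the value of \<open>C\<close>.\<close>

lemma winnable_conjI:
  assumes base: "\<And>I. holds I Map.empty Map.empty C"
    and step: "\<And>c b. c \<in> conj_clusters C \<Longrightarrow> winnable (resolve_conj c b C)"
  shows "winnable C"
proof -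
  have "\<exists>g. (\<forall>h k. g h \<subseteq>\<^sub>m g (h @ k)) \<and> (\<forall>h I. holds I (map_of h) (g h) (resolve_conj c b C))"
    if "c \<in> conj_clusters C" for c b
    using step[OF that] unfolding winnable_def .
  then obtain G where G: "\<And>c b h k. c \<in> conj_clusters C \<Longrightarrow> G c b h \<subseteq>\<^sub>m G c b (h @ k)"
    "\<And>c b h I. c \<in> conj_clusters C \<Longrightarrow> holds I (map_of h) (G c b h) (resolve_conj c b C)"
    by metis
  define rel where "rel h = filter (\<lambda>x. fst x \<in> conj_clusters C) h" for h :: "(string \<times> bool) list"
  define g where "g h = (case rel h of [] \<Rightarrow> Map.empty | (c, b) # h' \<Rightarrow> G c b h')" for h
  show ?thesis
  proof (rule winnableI)
    show "g h \<subseteq>\<^sub>m g (h @ k)" for h k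
    proof (cases "rel h")
      case (Cons x h')
      then have "rel (h @ k) = x # h' @ rel k" by (simp add: rel_def)
      moreover have "fst x \<in> conj_clusters C"
        using Cons unfolding rel_def by (metis filter_eq_ConsD)
      ultimately show ?thesis using Cons G(1) by (cases x) (auto simp: g_def)
    qed (simp add: g_def)
    show "holds I (map_of h) (g h) C" for h I
    proof -
      have "map_of (rel h) c = map_of h c" if "c \<in> conj_clusters C" for c
        using that by (induction h) (auto simp: rel_def)
      then have eq: "holds I (map_of h) (g h) C = holds I (map_of (rel h)) (g h) C"
        by (intro holds_cong) auto
      show ?thesis
      proof (cases "rel h")
        case Nil
        then show ?thesis using eq base by (simp add: g_def)
      next
        case (Cons x h')
        obtain c b where x: "x = (c, b)" by force
        have c: "c \<in> conj_clusters C"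
          using Cons x unfolding rel_def by (metis filter_eq_ConsD fst_conv)
        have "holds I (map_of h') (G c b h') (resolve_conj c b C)" using G(2)[OF c] .
        then have "holds I (map_of (rel h)) (G c b h') (resolve_conj c b C)"
          using Cons x by (simp add: holds_resolve_conj_upd)
        then have "holds I (map_of (rel h)) (G c b h') C"
          using Cons x by (simp add: holds_resolve_conj)
        then show ?thesis using eq Cons x by (simp add: g_def)
      qed
    qed
  qed
qed

text \<open>Stay idle until \<open>c\<close> is resolved, then follow the strategy of the selected
  branch on the whole history, including what came before that choice.\<close>

lemma winnable_splitting:
  assumes "winnable A" "winnable B" shows "winnable (CConj c A B)"
proof -
  obtain f where f: "\<And>h k. f h \<subseteq>\<^sub>m f (h @ k)" "\<And>h I. holds I (map_of h) (f h) A"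
    using assms(1) by (rule winnableE) blast
  obtain g where g: "\<And>h k. g h \<subseteq>\<^sub>m g (h @ k)" "\<And>h I. holds I (map_of h) (g h) B"
    using assms(2) by (rule winnableE) blast
  show ?thesis
  proof (rule winnableI)
    let ?k = "\<lambda>h. case map_of h c of None \<Rightarrow> Map.empty | Some b \<Rightarrow> if b then g h else f h"
    show "?k h \<subseteq>\<^sub>m ?k (h @ k)" for h k
      using f(1) g(1) by (auto split: option.split simp: map_add_def)
    show "holds I (map_of h) (?k h) (CConj c A B)" for h I
      using f(2) g(2) by (auto split: option.split)
  qed
qed

text \<open>The history for the premise of the quadrilemma rule: the choice of \<open>c\<close> is inserted right before
  the first choice of \<open>a\<close> or \<open>b\<close>.\<close>

fun insert_choice :: "string \<Rightarrow> string \<Rightarrow> string \<Rightarrow> (string \<times> bool) list \<Rightarrow> (string \<times> bool) list" where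
  "insert_choice a b c [] = []"
| "insert_choice a b c ((x, v) # h) =
     (if x = c then insert_choice a b c h
      else if x = a then (c, False) # (x, v) # filter (\<lambda>y. fst y \<noteq> c) h
      else if x = b then (c, True) # (x, v) # filter (\<lambda>y. fst y \<noteq> c) h
      else (x, v) # insert_choice a b c h)"

text \<open>The transformation of histories is causal, so composing a strategy with it keeps the
  strategy monotone.\<close>

lemma insert_choice_append: "\<exists>k'. insert_choice a b c (h @ k) = insert_choice a b c h @ k'"
  by (induction a b c h rule: insert_choice.induct) auto

lemma map_of_filter_neq: "x \<noteq> c \<Longrightarrow> map_of (filter (\<lambda>y. fst y \<noteq> c) h) x = map_of h x"
  by (induction h) auto

lemma map_of_insert_choice: "x \<noteq> c \<Longrightarrow> map_of (insert_choice a b c h) x = map_of h x"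
  by (induction a b c h rule: insert_choice.induct) (auto simp: map_of_filter_neq)

text \<open>While \<open>c\<close> is unresolved in the transformed history, both conjuncts of the
  conclusion of the quadrilemma are still open and thus true.\<close>

lemma insert_choice_None:
  assumes "a \<noteq> c" "b \<noteq> c" "map_of (insert_choice a b c h) c = None"
  shows "map_of h a = None" "map_of h b = None"
  using assms by (induction a b c h rule: insert_choice.induct) (auto split: if_splits)

text \<open>The root of the branch selected by \<open>c\<close> is resolved too, so winning in that
  branch is not vacuous.\<close>

lemma insert_choice_Some:
  assumes "a \<noteq> c" "b \<noteq> c" "map_of (insert_choice a b c h) c = Some v"
  shows "map_of h (if v then b else a) \<noteq> None"
  using assms by (induction a b c h rule: insert_choice.induct) (auto split: if_splits)

abbreviation quadri :: "string \<Rightarrow> string \<Rightarrow> string \<Rightarrow> cirq \<Rightarrow> cirq \<Rightarrow> cirq \<Rightarrow> cirq \<Rightarrow> cirq" where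
  "quadri a b c A B C D \<equiv> CConj c
     (CConj a (Conj A (CConj b C D)) (Conj B (CConj b C D)))
     (CConj b (Conj (CConj a A B) C) (Conj (CConj a A B) D))"

lemma winnable_quadrilemma:
  assumes "c \<notin> clusters Z" "E = Conj (CConj a A B) (CConj b C D)" "E \<in> subs Z"
    and "winnable (repl E (quadri a b c A B C D) Z)"
  shows "winnable Z"
proof -
  let ?F = "quadri a b c A B C D"
  have "conj_clusters E \<subseteq> conj_clusters Z" using assms(3) by (rule conj_clusters_subs)
  with assms(1,2) have c: "a \<noteq> c" "b \<noteq> c" by (auto simp: clusters_eq)
  obtain g where g: "\<And>h k. g h \<subseteq>\<^sub>m g (h @ k)" "\<And>h I. holds I (map_of h) (g h) (repl E ?F Z)"
    using assms(4) by (rule winnableE) blast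
  show ?thesis
  proof (rule winnableI)
    let ?i = "insert_choice a b c"
    show "g (?i h) \<subseteq>\<^sub>m g (?i (h @ k))" for h k
      using insert_choice_append[of a b c h k] g(1)[of "?i h"] by auto
    show "holds I (map_of h) (g (?i h)) Z" for h I
    proof -
      let ?r = "map_of (?i h)" and ?g = "g (?i h)"
      have ra: "?r a = map_of h a" and rb: "?r b = map_of h b"
        using c by (simp_all add: map_of_insert_choice)
      \<comment> \<open>If \<open>c\<close> is open, \<open>E\<close> is true because
        \<open>a\<close> and \<open>b\<close> are open. Otherwise the selected branch, with its root
        resolved, unfolds to the value of \<open>E\<close>.\<close>
      have "holds I ?r ?g ?F \<Longrightarrow> holds I ?r ?g E"
        using insert_choice_None[OF c, of h] insert_choice_Some[OF c, of h] ra rb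
        unfolding assms(2) by (cases "?r c") (auto split: option.splits if_splits)
      with g(2)[of I "?i h"] have "holds I ?r ?g Z"
        by (rule holds_repl_mono'[rotated])
      \<comment> \<open>\<open>c\<close> does not occur in \<open>Z\<close>, so the real and the
        transformed history give \<open>Z\<close> the same value.\<close>
      then show ?thesis
        using assms(1) holds_cong[of Z ?r "map_of h" ?g ?g I]
        by (metis UnI2 clusters_eq map_of_insert_choice)
    qed
  qed
qed

lemma provable_imp_winnable: "provable Cd Cc C \<Longrightarrow> winnable C"
proof (induction rule: provable.induct)
  case axiom
  then show ?case by (intro winnableI[of "\<lambda>_. Map.empty"]) auto
next
  case (local Z F E)
  from local.IH show ?case
    by (rule winnable_mono) (metis holds_local_rule[OF local.hyps(2)] holds_repl_mono')
next
  case (choosing Z c A B b)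
  then show ?case using winnable_resolve_disjD by blast
next
  case (cleansing1 Z c Y C A B)
  \<comment> \<open>The left branch counts only when \<open>r c = Some False\<close>, and then
    \<open>CConj c A B\<close> has the value of \<open>A\<close>.\<close>
  have "holds I r g (CConj c (repl (CConj c A B) A Y) C) \<Longrightarrow> holds I r g (CConj c Y C)" for I r g
    using holds_repl_mono'[of I r g A "CConj c A B" Y] by (auto split: option.splits if_splits)
  then show ?case
    using winnable_mono[OF cleansing1.IH] holds_repl_mono' by metis
next
  case (cleansing2 Z c C Y A B)
  have "holds I r g (CConj c C (repl (CConj c A B) B Y)) \<Longrightarrow> holds I r g (CConj c C Y)" for I r g
    using holds_repl_mono'[of I r g B "CConj c A B" Y] by (auto split: option.splits if_splits)
  then show ?case
    using winnable_mono[OF cleansing2.IH] holds_repl_mono' by metis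
next
  case (quadrilemma Z c a A B b C D)
  then show ?case using winnable_quadrilemma by blast
next
  case (splitting c A B)
  then show ?case using winnable_splitting by blast
qed

section \<open>Completeness of the rules\<close>

text \<open>Calibrated so that no premise of a rule other than associativity of \<open>\<and>\<close> has a larger rank than
  the conclusion, with equality for distribution over \<open>\<and>\<close> and for the quadrilemma, while splitting
  decreases the rank.\<close>

primrec rank :: "cirq \<Rightarrow> nat" where
  "rank CTop = 1"
| "rank CBot = 1"
| "rank (Lit p) = 1"
| "rank (NLit p) = 1"
| "rank (Disj A B) = rank A * rank B"
| "rank (Conj A B) = 2 * (rank A + rank B)"
| "rank (CDisj c A B) = Suc (max (rank A) (rank B))"
| "rank (CConj c A B) = Suc (max (rank A) (rank B))"

text \<open>A termination measure for pulling \<open>\<and>\<close> and \<open>\<sqinter>\<close> out of \<open>\<or>\<close>, blind to what lies inside a choice.\<close>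

primrec weight :: "cirq \<Rightarrow> nat" where
  "weight CTop = 2"
| "weight CBot = 2"
| "weight (Lit p) = 2"
| "weight (NLit p) = 2"
| "weight (Disj A B) = weight A * weight B"
| "weight (Conj A B) = Suc (weight A + weight B)"
| "weight (CDisj c A B) = 2"
| "weight (CConj c A B) = 2"

text \<open>The subcirquents not below a choice connective: the places where \<open>weight\<close>
  notices a change.\<close>

primrec surface :: "cirq \<Rightarrow> cirq set" where
  "surface CTop = {CTop}"
| "surface CBot = {CBot}"
| "surface (Lit p) = {Lit p}"
| "surface (NLit p) = {NLit p}"
| "surface (Disj A B) = insert (Disj A B) (surface A \<union> surface B)"
| "surface (Conj A B) = insert (Conj A B) (surface A \<union> surface B)"
| "surface (CDisj c A B) = {CDisj c A B}"
| "surface (CConj c A B) = {CConj c A B}"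

section \<open>Rank and weight under replacement\<close>

lemma surface_refl [simp]: "C \<in> surface C"
  by (cases C) auto

lemma surface_subs: "A \<in> surface C \<Longrightarrow> A \<in> subs C"
  by (induction C) auto

lemma surface_trans: "B \<in> surface C \<Longrightarrow> A \<in> surface B \<Longrightarrow> A \<in> surface C"
  by (induction C) auto

lemma size_surface: "A \<in> surface C \<Longrightarrow> size A \<le> size C"
  by (induction C) auto

lemma repl_self [simp]: "repl E F E = F"
  by (cases E) auto

lemma rank_pos: "rank C \<ge> 1"
  by (induction C) auto

lemma weight_ge2: "weight C \<ge> 2"
proof (induction C)
  case (Disj A B)
  then have "2 * 2 \<le> weight A * weight B" by (intro mult_le_mono)
  then show ?case by simp
qed auto

lemma rank_repl:
  assumes "rank F \<le> rank E" shows "rank (repl E F Z) \<le> rank Z"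
proof (induction Z)
  case (Disj A B)
  then show ?case using assms by (auto intro: mult_le_mono)
qed (use assms in auto)

lemma weight_repl:
  assumes "weight F \<le> weight E" shows "weight (repl E F Z) \<le> weight Z"
proof -
  have "2 \<le> weight F" by (rule weight_ge2)
  show ?thesis
  proof (induction Z)
    case (Disj A B)
    then show ?case using assms by (auto intro: mult_le_mono)
  qed (use assms \<open>2 \<le> weight F\<close> in auto)
qed

text \<open>\<open>repl\<close> may also hit other occurrences, which never raises the weight. One
  surface occurrence makes the inequality strict, and positivity of weights carries this through
  products.\<close>

lemma weight_repl_strict:
  assumes "weight F < weight E" "E \<in> surface Z" shows "weight (repl E F Z) < weight Z"
proof -
  have le: "weight (repl E F C) \<le> weight C" for C
    using assms(1) by (intro weight_repl) simp
  show ?thesis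
    using assms(2)
  proof (induction Z)
    case (Disj A B)
    show ?case
    proof (cases "Disj A B = E")
      case True
      then show ?thesis using assms(1) by auto
    next
      case False
      with Disj consider "weight (repl E F A) < weight A" | "weight (repl E F B) < weight B" by auto
      then show ?thesis
      proof cases
        case 1
        then have "weight (repl E F A) * weight (repl E F B) < weight A * weight B"
          using le[of B] weight_ge2[of "repl E F B"] by (intro mult_less_le_imp_less) auto
        with False show ?thesis by simp
      next
        case 2
        then have "weight (repl E F A) * weight (repl E F B) < weight A * weight B"
          using le[of A] weight_ge2[of "repl E F A"] by (intro mult_le_less_imp_less) auto
        with False show ?thesis by simp
      qed
    qed
  next
    case (Conj A B)
    then show ?case using assms(1) le[of A] le[of B] by auto
  qed (use assms(1) in auto)
qed

text \<open>Anything properly enclosing \<open>D\<close> is larger than \<open>E\<close> and is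
  therefore not itself replaced.\<close>

lemma surface_repl:
  assumes "D \<in> surface Z" "E \<in> surface D" shows "repl E F D \<in> surface (repl E F Z)"
  using assms by (induction Z) (fastforce dest: size_surface)+

lemma rank_resolve_disj: "rank (resolve_disj c b C) \<le> rank C"
  by (induction C) (auto intro: mult_le_mono)

lemma rank_resolve_conj: "rank (resolve_conj c b C) \<le> rank C"
  by (induction C) (auto intro: mult_le_mono)

section \<open>Rewriting on the surface\<close>

text \<open>These steps rearrange a disjunction until a redex appears. Associativity of
  \<open>Conj\<close> is left out because it can raise \<open>rank\<close>.\<close>

inductive ac_rule :: "cirq \<Rightarrow> cirq \<Rightarrow> bool" where
  "ac_rule (Disj B A) (Disj A B)"
| "ac_rule (Conj B A) (Conj A B)"
| "ac_rule (Disj A (Disj B C)) (Disj (Disj A B) C)"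

text \<open>In the last clause \<open>c\<close> is arbitrary, so that being a redex depends on shape
  alone; a fresh \<open>c\<close> is picked when the step is carried out.\<close>

inductive reducing_rule :: "cirq \<Rightarrow> cirq \<Rightarrow> bool" where
  "reducing_rule A (Disj A CBot)"
| "reducing_rule A (Conj A CTop)"
| "reducing_rule CTop (Disj A CTop)"
| "reducing_rule (Conj (Disj A C) (Disj B C)) (Disj (Conj A B) C)"
| "reducing_rule (CConj c (Disj A C) (Disj B C)) (Disj (CConj c A B) C)"
| "reducing_rule CTop (Disj (NLit p) (Lit p))"
| "reducing_rule (quadri a b c A B C D) (Conj (CConj a A B) (CConj b C D))"

lemma ac_rule_local: "ac_rule F E \<Longrightarrow> local_rule F E"
  by (induction rule: ac_rule.induct) (auto intro: local_rule.intros)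

lemma reducing_rule_cases:
  assumes "reducing_rule F E"
  shows "local_rule F E \<or>
    (\<exists>a b c A B C D. E = Conj (CConj a A B) (CConj b C D) \<and> F = quadri a b c A B C D)"
  using assms by cases (auto intro: local_rule.intros)

lemma ac_rule_rank: "ac_rule F E \<Longrightarrow> rank F \<le> rank E"
  by (induction rule: ac_rule.induct) auto

lemma ac_rule_weight: "ac_rule F E \<Longrightarrow> weight F \<le> weight E"
  by (induction rule: ac_rule.induct) auto

lemma ac_rule_clusters:
  "ac_rule F E \<Longrightarrow> disj_clusters F \<subseteq> disj_clusters E \<and> conj_clusters F \<subseteq> conj_clusters E"
  by (induction rule: ac_rule.induct) auto

lemma reducing_rule_rank:
  assumes "reducing_rule F E" shows "rank F \<le> rank E"
  using assms
proof cases
  case (3 A)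
  then show ?thesis using rank_pos[of A] by simp
next
  case (5 c A C B)
  have "rank A * rank C \<le> max (rank A) (rank B) * rank C" "rank B * rank C \<le> max (rank A) (rank B) * rank C"
    by (intro mult_le_mono; simp)+
  then have "max (rank A * rank C) (rank B * rank C) \<le> max (rank A) (rank B) * rank C" by simp
  then show ?thesis using 5 rank_pos[of C] by (simp del: max.bounded_iff)
qed (auto simp: algebra_simps)

lemma reducing_rule_weight:
  assumes "reducing_rule F E" shows "weight F < weight E"
  using assms
proof cases
  case 1
  then show ?thesis using weight_ge2[of F] by simp
next
  case (3 A)
  then show ?thesis using weight_ge2[of A] by simp
next
  case (4 A C B)
  then show ?thesis using weight_ge2[of C] by (simp add: algebra_simps)
next
  case (5 c A C B)
  then show ?thesis using weight_ge2[of C] by simp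
qed auto

lemma reducing_rule_disj_clusters: "reducing_rule F E \<Longrightarrow> disj_clusters F \<subseteq> disj_clusters E"
  by (induction rule: reducing_rule.induct) auto

text \<open>For the quadrilemma only this direction holds valuation by valuation: with
  \<open>c\<close> open the premise is true whatever happens to \<open>a\<close> and
  \<open>b\<close>.\<close>

lemma reducing_rule_holds: "reducing_rule F E \<Longrightarrow> holds I r g E \<Longrightarrow> holds I r g F"
  by (induction rule: reducing_rule.induct) (auto split: option.splits if_splits)

definition ac_step :: "cirq \<Rightarrow> cirq \<Rightarrow> bool" where
  "ac_step Z Z' \<longleftrightarrow> (\<exists>E F. E \<in> surface Z \<and> ac_rule F E \<and> Z' = repl E F Z)"

lemma ac_stepE:
  assumes "ac_step Z Z'"
  obtains E F where "E \<in> surface Z" "ac_rule F E" "Z' = repl E F Z"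
  using assms unfolding ac_step_def by blast

lemma ac_stepI: "E \<in> surface Z \<Longrightarrow> ac_rule F E \<Longrightarrow> ac_step Z (repl E F Z)"
  unfolding ac_step_def by blast

definition redex :: "cirq \<Rightarrow> bool" where
  "redex E \<longleftrightarrow> (\<exists>F. reducing_rule F E)"

definition reducible :: "cirq \<Rightarrow> bool" where
  "reducible Z \<longleftrightarrow> (\<exists>Z' E. ac_step\<^sup>*\<^sup>* Z Z' \<and> E \<in> surface Z' \<and> redex E)"

lemma reducibleI: "ac_step\<^sup>*\<^sup>* Z Z' \<Longrightarrow> E \<in> surface Z' \<Longrightarrow> reducing_rule F E \<Longrightarrow> reducible Z"
  unfolding reducible_def redex_def by blast

lemma ac_step_root: "ac_rule F E \<Longrightarrow> ac_step E F"
  unfolding ac_step_def by (metis repl_self surface_refl)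

text \<open>Each step inside \<open>D\<close> is replayed on the whole cirquent with the same
  \<open>E\<close> and \<open>F\<close>. Other parts may change along with \<open>D\<close>, hence
  only the existence of some \<open>Z'\<close>.\<close>

lemma ac_steps_surface:
  assumes "ac_step\<^sup>*\<^sup>* D D'" "D \<in> surface Z"
  shows "\<exists>Z'. ac_step\<^sup>*\<^sup>* Z Z' \<and> D' \<in> surface Z'"
  using assms(1)
proof (induction rule: rtranclp_induct)
  case (step D1 D2)
  from step.IH obtain Z1 where Z1: "ac_step\<^sup>*\<^sup>* Z Z1" "D1 \<in> surface Z1" by blast
  from step.hyps(2) obtain E F where EF: "E \<in> surface D1" "ac_rule F E" "D2 = repl E F D1"
    by (rule ac_stepE)
  have "ac_step Z1 (repl E F Z1)" using Z1 EF by (blast intro: ac_stepI surface_trans)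
  with Z1(1) have "ac_step\<^sup>*\<^sup>* Z (repl E F Z1)" by (rule rtranclp.rtrancl_into_rtrancl)
  moreover have "D2 \<in> surface (repl E F Z1)" using Z1 EF surface_repl by blast
  ultimately show ?case by blast
qed (use assms(2) in auto)

lemma reducible_surface:
  assumes "D \<in> surface Z" "reducible D" shows "reducible Z"
  using assms ac_steps_surface surface_trans unfolding reducible_def by meson

section \<open>Clauses and irreducible tautologies\<close>

primrec lits :: "cirq \<Rightarrow> cirq set" where
  "lits CTop = {}"
| "lits CBot = {}"
| "lits (Lit p) = {Lit p}"
| "lits (NLit p) = {NLit p}"
| "lits (Disj A B) = lits A \<union> lits B"
| "lits (Conj A B) = lits A \<union> lits B"
| "lits (CDisj c A B) = {}"
| "lits (CConj c A B) = {}"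

text \<open>With all choices open a choice disjunction is false, so it counts as a false atom.
  Excluded are \<open>CTop\<close> and the connectives that a reducing step can pull out of a
  disjunction.\<close>

primrec clause :: "cirq \<Rightarrow> bool" where
  "clause CTop = False"
| "clause CBot = True"
| "clause (Lit p) = True"
| "clause (NLit p) = True"
| "clause (Disj A B) = (clause A \<and> clause B)"
| "clause (Conj A B) = False"
| "clause (CDisj c A B) = True"
| "clause (CConj c A B) = False"

lemma ac_rule_lits: "ac_rule F E \<Longrightarrow> lits F = lits E"
  by (induction rule: ac_rule.induct) auto

lemma ac_rule_clause: "ac_rule F E \<Longrightarrow> clause F = clause E"
  by (induction rule: ac_rule.induct) auto

lemma lits_repl:
  assumes "lits F = lits E" shows "lits (repl E F Z) = lits Z"
proof (induction Z)
  case CTop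
  then show ?case using assms by (cases "E = CTop") simp_all
next
  case CBot
  then show ?case using assms by (cases "E = CBot") simp_all
next
  case (Lit p)
  then show ?case using assms by (cases "E = Lit p") simp_all
next
  case (NLit p)
  then show ?case using assms by (cases "E = NLit p") simp_all
next
  case (Disj A B)
  then show ?case using assms by (cases "E = Disj A B") simp_all
next
  case (Conj A B)
  then show ?case using assms by (cases "E = Conj A B") simp_all
next
  case (CDisj c A B)
  then show ?case using assms by (cases "E = CDisj c A B") simp_all
next
  case (CConj c A B)
  then show ?case using assms by (cases "E = CConj c A B") simp_all
qed

lemma clause_repl:
  assumes "clause F = clause E" shows "clause (repl E F Z) = clause Z"
proof (induction Z)
  case CTop
  then show ?case using assms by (cases "E = CTop") simp_all
next
  case CBot
  then show ?case using assms by (cases "E = CBot") simp_all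
next
  case (Lit p)
  then show ?case using assms by (cases "E = Lit p") simp_all
next
  case (NLit p)
  then show ?case using assms by (cases "E = NLit p") simp_all
next
  case (Disj A B)
  then show ?case using assms by (cases "E = Disj A B") simp_all
next
  case (Conj A B)
  then show ?case using assms by (cases "E = Conj A B") simp_all
next
  case (CDisj c A B)
  then show ?case using assms by (cases "E = CDisj c A B") simp_all
next
  case (CConj c A B)
  then show ?case using assms by (cases "E = CConj c A B") simp_all
qed

lemma ac_step_lits: "ac_step D D' \<Longrightarrow> lits D' = lits D"
  by (erule ac_stepE) (simp add: lits_repl[OF ac_rule_lits])

lemma ac_step_clause: "ac_step D D' \<Longrightarrow> clause D' = clause D"
  by (erule ac_stepE) (simp add: clause_repl[OF ac_rule_clause])

lemma ac_steps_lits: "ac_step\<^sup>*\<^sup>* D D' \<Longrightarrow> lits D' = lits D"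
  by (induction rule: rtranclp_induct) (simp_all add: ac_step_lits)

lemma ac_steps_clause: "ac_step\<^sup>*\<^sup>* D D' \<Longrightarrow> clause D' = clause D"
  by (induction rule: rtranclp_induct) (simp_all add: ac_step_clause)

definition is_lit :: "cirq \<Rightarrow> bool" where
  "is_lit l \<longleftrightarrow> (\<exists>p. l = Lit p \<or> l = NLit p)"

lemma repl_lit: "is_lit l \<Longrightarrow> ac_rule F E \<Longrightarrow> repl E F l = l"
  by (auto simp: is_lit_def elim: ac_rule.cases)

text \<open>Replacement acts on all occurrences, so rewriting \<open>X\<close> may disturb its
  neighbour \<open>Y\<close>; a literal is never touched. The root is safe because it is larger than
  any \<open>E\<close> inside \<open>X\<close>.\<close>

lemma ac_steps_Disj_left:
  assumes "ac_step\<^sup>*\<^sup>* X X'"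
  shows "\<exists>Y'. ac_step\<^sup>*\<^sup>* (Disj X Y) (Disj X' Y') \<and> (is_lit Y \<longrightarrow> Y' = Y)"
  using assms
proof (induction rule: rtranclp_induct)
  case (step X1 X2)
  from step.IH obtain Y1 where Y1: "ac_step\<^sup>*\<^sup>* (Disj X Y) (Disj X1 Y1)" "is_lit Y \<longrightarrow> Y1 = Y" by blast
  from step.hyps(2) obtain E F where "E \<in> surface X1" "ac_rule F E" "X2 = repl E F X1"
    by (rule ac_stepE)
  note * = Y1 this
  have "size E < size (Disj X1 Y1)" using *(2) *(3) size_surface[of E] by fastforce
  then have "Disj X1 Y1 \<noteq> E" by blast
  then have "repl E F (Disj X1 Y1) = Disj X2 (repl E F Y1)" using * by simp
  moreover have "ac_step (Disj X1 Y1) (repl E F (Disj X1 Y1))"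
    using * by (intro ac_stepI) auto
  ultimately have "ac_step\<^sup>*\<^sup>* (Disj X Y) (Disj X2 (repl E F Y1))"
    using *(1) by (metis rtranclp.rtrancl_into_rtrancl)
  moreover have "is_lit Y \<longrightarrow> repl E F Y1 = Y" using * repl_lit by auto
  ultimately show ?case by blast
qed auto

lemma ac_steps_Disj_right:
  assumes "ac_step\<^sup>*\<^sup>* Y Y'"
  shows "\<exists>X'. ac_step\<^sup>*\<^sup>* (Disj X Y) (Disj X' Y')"
  using assms
proof (induction rule: rtranclp_induct)
  case (step Y1 Y2)
  from step.IH obtain X1 where X1: "ac_step\<^sup>*\<^sup>* (Disj X Y) (Disj X1 Y1)" by blast
  from step.hyps(2) obtain E F where "E \<in> surface Y1" "ac_rule F E" "Y2 = repl E F Y1"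
    by (rule ac_stepE)
  note * = X1 this
  have "size E < size (Disj X1 Y1)" using *(2) *(3) size_surface[of E] by fastforce
  then have "Disj X1 Y1 \<noteq> E" by blast
  then have "repl E F (Disj X1 Y1) = Disj (repl E F X1) Y2" using * by simp
  moreover have "ac_step (Disj X1 Y1) (repl E F (Disj X1 Y1))"
    using * by (intro ac_stepI) auto
  ultimately show ?case using *(1) by (metis rtranclp.rtrancl_into_rtrancl)
qed auto

lemma ac_steps_extract_left:
  assumes "X = l \<or> (\<exists>R. ac_step\<^sup>*\<^sup>* X (Disj l R))"
  shows "\<exists>R. ac_step\<^sup>*\<^sup>* (Disj X Y) (Disj l R)"
proof (cases "X = l")
  case False
  then obtain R where "ac_step\<^sup>*\<^sup>* X (Disj l R)" using assms by blast
  from ac_steps_Disj_left[OF this] obtain Y' where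
    "ac_step\<^sup>*\<^sup>* (Disj X Y) (Disj (Disj l R) Y')" by blast
  also have "ac_step \<dots> (Disj l (Disj R Y'))"
    by (intro ac_step_root ac_rule.intros)
  finally show ?thesis by blast
qed auto

text \<open>Commute the side containing \<open>l\<close> to the left, extract \<open>l\<close>
  there, and reassociate to the right.\<close>

lemma ac_steps_extract:
  assumes "clause D" "l \<in> lits D"
  shows "D = l \<or> (\<exists>R. ac_step\<^sup>*\<^sup>* D (Disj l R))"
  using assms
proof (induction D)
  case (Disj X Y)
  show ?case
  proof (cases "l \<in> lits X")
    case True
    then show ?thesis using Disj ac_steps_extract_left by simp
  next
    case False
    then have "\<exists>R. ac_step\<^sup>*\<^sup>* (Disj Y X) (Disj l R)"
      using Disj by (intro ac_steps_extract_left) auto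
    moreover have "ac_step (Disj X Y) (Disj Y X)"
      by (intro ac_step_root ac_rule.intros)
    ultimately show ?thesis by (meson converse_rtranclp_into_rtranclp)
  qed
qed auto

lemma holds_clause:
  assumes "clause D"
  shows "holds I Map.empty Map.empty D \<longleftrightarrow>
    (\<exists>p. Lit p \<in> lits D \<and> I p) \<or> (\<exists>p. NLit p \<in> lits D \<and> \<not> I p)"
  using assms by (induction D) auto

lemma tautological_clause_reducible:
  assumes "clause D" "\<And>I. holds I Map.empty Map.empty D"
  shows "reducible D"
proof -
  obtain p where p: "Lit p \<in> lits D" "NLit p \<in> lits D"
    \<comment> \<open>This interpretation falsifies every negative literal of \<open>D\<close>, so
      some \<open>Lit p\<close> in \<open>D\<close> is true, which means that \<open>NLit p\<close>
      occurs as well.\<close>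
    using assms(2)[of "\<lambda>p. NLit p \<in> lits D"] holds_clause[OF assms(1)] by auto
  then have "D \<noteq> NLit p" by auto
  then obtain R where R: "ac_step\<^sup>*\<^sup>* D (Disj (NLit p) R)"
    using ac_steps_extract[OF assms(1) p(2)] by blast
  then have "clause R" "Lit p \<in> lits R"
    using ac_steps_clause[OF R] ac_steps_lits[OF R] assms(1) p by auto
  then consider "R = Lit p" | R2 where "ac_step\<^sup>*\<^sup>* R (Disj (Lit p) R2)"
    using ac_steps_extract by blast
  then show ?thesis
  proof cases
    case 1
    then show ?thesis using R by (auto intro: reducibleI reducing_rule.intros)
  next
    \<comment> \<open>Parking the literal \<open>NLit p\<close> on the right keeps it intact while
      \<open>R\<close> is rewritten. Reassociation then joins it with \<open>Lit p\<close>. The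
      final swap of the two may also occur inside \<open>R2\<close>, turning it into some
      \<open>R3\<close>.\<close>
    case 2
    have "ac_step\<^sup>*\<^sup>* R (Disj (Lit p) R2)" by fact
    also have "ac_step (Disj (Lit p) R2) (Disj R2 (Lit p))" by (intro ac_step_root ac_rule.intros)
    finally have "ac_step\<^sup>*\<^sup>* (Disj R (NLit p)) (Disj (Disj R2 (Lit p)) (NLit p))"
      using ac_steps_Disj_left[of R "Disj R2 (Lit p)" "NLit p"] by (auto simp: is_lit_def)
    moreover have "ac_step\<^sup>*\<^sup>* (Disj (Lit p) (NLit p)) (Disj (NLit p) (Lit p))"
      by (intro r_into_rtranclp ac_step_root ac_rule.intros)
    then obtain R3 where "ac_step\<^sup>*\<^sup>* (Disj R2 (Disj (Lit p) (NLit p))) (Disj R3 (Disj (NLit p) (Lit p)))"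
      using ac_steps_Disj_right by blast
    moreover have "ac_step (Disj (Disj R2 (Lit p)) (NLit p)) (Disj R2 (Disj (Lit p) (NLit p)))"
      "ac_step (Disj (NLit p) R) (Disj R (NLit p))"
      by (intro ac_step_root ac_rule.intros)+
    ultimately have "ac_step\<^sup>*\<^sup>* D (Disj R3 (Disj (NLit p) (Lit p)))"
      using R by (meson rtranclp.rtrancl_into_rtrancl rtranclp_trans)
    then show ?thesis by (rule reducibleI[where E = "Disj (NLit p) (Lit p)"]) (auto intro: reducing_rule.intros)
  qed
qed

lemma reducible_root: "reducing_rule F E \<Longrightarrow> reducible E"
  using reducibleI[of E E E F] by simp

lemma reducible_Disj_commute: "reducing_rule F (Disj B A) \<Longrightarrow> reducible (Disj A B)"
  by (rule reducibleI[of _ "Disj B A" "Disj B A" F]) (auto intro: r_into_rtranclp ac_step_root ac_rule.intros)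

lemma reducible_Conj_commute: "reducing_rule F (Conj B A) \<Longrightarrow> reducible (Conj A B)"
  by (rule reducibleI[of _ "Conj B A" "Conj B A" F]) (auto intro: r_into_rtranclp ac_step_root ac_rule.intros)

text \<open>In a disjunction, a part of any shape other than a clause would give a redex at the
  root, possibly after commuting.\<close>

lemma irreducible_cases:
  assumes "\<not> reducible D"
  shows "D = CTop \<or> (\<exists>c A B. D = CConj c A B) \<or> (\<exists>A B. D = Conj A B) \<or> clause D"
  using assms
proof (induction D)
  case (Disj A B)
  have "\<not> reducible A" "\<not> reducible B"
    using Disj.prems reducible_surface[of A "Disj A B"] reducible_surface[of B "Disj A B"] by auto
  moreover have "A \<noteq> CTop" "\<And>c X Y. A \<noteq> CConj c X Y" "\<And>X Y. A \<noteq> Conj X Y"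
    using Disj.prems by (auto intro: reducible_root reducible_Disj_commute reducing_rule.intros)
  moreover have "B \<noteq> CTop" "\<And>c X Y. B \<noteq> CConj c X Y" "\<And>X Y. B \<noteq> Conj X Y"
    using Disj.prems by (auto intro: reducible_root reducible_Disj_commute reducing_rule.intros)
  ultimately show ?case using Disj.IH by auto
qed auto

text \<open>Both parts of a conjunction would again be irreducible tautologies; a part
  \<open>CTop\<close> invites identity, and two choice conjunctions invite the quadrilemma.\<close>

lemma irreducible_tautology:
  assumes "\<not> reducible D" "\<And>I. holds I Map.empty Map.empty D"
  shows "D = CTop \<or> (\<exists>c A B. D = CConj c A B)"
  using assms
proof (induction D)
  case (Lit p)
  then show ?case using tautological_clause_reducible by auto
next
  case (NLit p)
  then show ?case using tautological_clause_reducible by auto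
next
  case (Disj A B)
  then show ?case using irreducible_cases[of "Disj A B"] tautological_clause_reducible by blast
next
  case (Conj A B)
  have "\<not> reducible A" "\<not> reducible B"
    using Conj.prems reducible_surface[of A "Conj A B"] reducible_surface[of B "Conj A B"] by auto
  then have "A = CTop \<or> (\<exists>c X Y. A = CConj c X Y)" "B = CTop \<or> (\<exists>c X Y. B = CConj c X Y)"
    using Conj by auto
  then have "reducible (Conj A B)"
    by (auto intro: reducible_root reducible_Conj_commute reducing_rule.intros)
  then show ?case using Conj.prems by blast
qed auto

section \<open>Rewriting preserves winnability and reflects provability\<close>

lemma wf_repl:
  assumes "wf_cirq Cd Cc Z" "E \<in> subs Z" "disj_clusters F \<subseteq> disj_clusters E" "conj_clusters F \<subseteq> conj_clusters E \<union> Cc"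
  shows "wf_cirq Cd Cc (repl E F Z)"
proof -
  note disj_clusters_repl[of E F Z] conj_clusters_repl[of E F Z]
    disj_clusters_subs[OF assms(2)] conj_clusters_subs[OF assms(2)]
  with assms(1,3,4) show ?thesis unfolding wf_cirq_iff by blast
qed

lemma ac_steps_preserve:
  assumes "ac_step\<^sup>*\<^sup>* Z Z'" "wf_cirq Cd Cc Z"
  shows "wf_cirq Cd Cc Z' \<and> rank Z' \<le> rank Z \<and> weight Z' \<le> weight Z \<and> disj_clusters Z' \<subseteq> disj_clusters Z
    \<and> (winnable Z \<longrightarrow> winnable Z') \<and> (provable Cd Cc Z' \<longrightarrow> provable Cd Cc Z)"
  using assms(1)
proof (induction rule: rtranclp_induct)
  case (step Z1 Z2)
  from step.hyps(2) obtain E F where E: "E \<in> subs Z1" "ac_rule F E" "Z2 = repl E F Z1"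
    by (rule ac_stepE) (blast intro: surface_subs)
  note cl = ac_rule_clusters[OF E(2)]
  have "wf_cirq Cd Cc Z2" unfolding E(3) using step.IH E(1) cl by (intro wf_repl) auto
  moreover have "rank Z2 \<le> rank Z1" "weight Z2 \<le> weight Z1"
    unfolding E(3) using E(2) by (auto intro: rank_repl weight_repl ac_rule_rank ac_rule_weight)
  moreover have "disj_clusters Z2 \<subseteq> disj_clusters Z1"
    using disj_clusters_repl[of E F Z1] disj_clusters_subs[OF E(1)] cl E(3) by blast
  moreover have "winnable Z1 \<Longrightarrow> winnable Z2"
    unfolding E(3) by (erule winnable_mono) (metis holds_repl_mono holds_local_rule ac_rule_local E(2))
  moreover have "provable Cd Cc Z2 \<Longrightarrow> provable Cd Cc Z1"
    using provable.local[OF _ ac_rule_local[OF E(2)] E(1)] step.IH E(3) by blast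
  ultimately show ?case using step.IH by auto
qed (use assms(2) in auto)

lemma exists_reducing_step:
  assumes "wf_cirq Cd Cc Z" "infinite Cc" "E \<in> surface Z" "redex E"
  shows "\<exists>Z'. wf_cirq Cd Cc Z' \<and> rank Z' \<le> rank Z \<and> weight Z' < weight Z \<and> disj_clusters Z' \<subseteq> disj_clusters Z
    \<and> (winnable Z \<longrightarrow> winnable Z') \<and> (provable Cd Cc Z' \<longrightarrow> provable Cd Cc Z)"
proof -
  note E = surface_subs[OF assms(3)]
  have *: "rank (repl E F Z) \<le> rank Z" "weight (repl E F Z) < weight Z"
    "disj_clusters (repl E F Z) \<subseteq> disj_clusters Z" "winnable Z \<Longrightarrow> winnable (repl E F Z)"
    if "reducing_rule F E" for F
  proof -
    show "rank (repl E F Z) \<le> rank Z" using that by (intro rank_repl reducing_rule_rank)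
    show "weight (repl E F Z) < weight Z"
      using that assms(3) by (intro weight_repl_strict reducing_rule_weight)
    show "disj_clusters (repl E F Z) \<subseteq> disj_clusters Z"
      using disj_clusters_repl[of E F Z] disj_clusters_subs[OF E] reducing_rule_disj_clusters[OF that] by blast
    show "winnable Z \<Longrightarrow> winnable (repl E F Z)"
      by (erule winnable_mono) (metis holds_repl_mono reducing_rule_holds[OF that])
  qed
  obtain F where F: "reducing_rule F E" using assms(4) unfolding redex_def by blast
  show ?thesis
  proof (cases "local_rule F E")
    case True
    then have "conj_clusters F \<subseteq> conj_clusters E"
      by (induction rule: local_rule.induct) auto
    then have "wf_cirq Cd Cc (repl E F Z)"
      using assms(1) E reducing_rule_disj_clusters[OF F] by (intro wf_repl) auto
    then show ?thesis using *[OF F] provable.local[OF assms(1) True E] by blast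
  next
    \<comment> \<open>The cluster introduced by \<open>F\<close> need not be new. The shape of
      \<open>E\<close> allows the step to be redone with a fresh one.\<close>
    case False
    then obtain a b A B C D where eq: "E = Conj (CConj a A B) (CConj b C D)"
      using reducing_rule_cases[OF F] by blast
    obtain c where c: "c \<in> Cc" "c \<notin> clusters Z"
      using assms(2) finite_clusters[of Z] by (meson ex_new_if_finite finite_subset subsetI)
    let ?F = "quadri a b c A B C D"
    have r: "reducing_rule ?F E" unfolding eq by (rule reducing_rule.intros)
    have "conj_clusters ?F \<subseteq> conj_clusters E \<union> Cc" using eq c by auto
    then have "wf_cirq Cd Cc (repl E ?F Z)"
      using assms(1) E reducing_rule_disj_clusters[OF r] by (intro wf_repl) auto
    then show ?thesis using *[OF r] provable.quadrilemma[OF assms(1) c E[unfolded eq]] eq by blast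
  qed
qed

section \<open>Cleansing and the completeness induction\<close>

text \<open>A cleansing step does part of what resolving \<open>c\<close> does anyway, so it leaves
  the final result unchanged.\<close>

lemma resolve_conj_repl: "resolve_conj c b (repl (CConj c A B) (if b then B else A) P) = resolve_conj c b P"
  by (induction P) auto

lemma exists_CConj_subs: "c \<in> conj_clusters P \<Longrightarrow> \<exists>A B. CConj c A B \<in> subs P"
  by (induction P) auto

lemma exists_CDisj_subs: "c \<in> disj_clusters P \<Longrightarrow> \<exists>A B. CDisj c A B \<in> subs P"
  by (induction P) auto

lemma size_repl_le: "size F \<le> size E \<Longrightarrow> size (repl E F P) \<le> size P"
  by (induction P) auto

lemma size_repl_less: "size F < size E \<Longrightarrow> E \<in> subs P \<Longrightarrow> size (repl E F P) < size P"
proof (induction P)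
  case (Disj A B)
  then show ?case using size_repl_le[of F E A] size_repl_le[of F E B] by auto
next
  case (Conj A B)
  then show ?case using size_repl_le[of F E A] size_repl_le[of F E B] by auto
next
  case (CDisj c A B)
  then show ?case using size_repl_le[of F E A] size_repl_le[of F E B] by auto
next
  case (CConj c A B)
  then show ?case using size_repl_le[of F E A] size_repl_le[of F E B] by auto
qed auto

lemma wf_repl_CConj:
  "wf_cirq Cd Cc P \<Longrightarrow> CConj c A B \<in> subs P \<Longrightarrow> wf_cirq Cd Cc (repl (CConj c A B) (if b then B else A) P)"
  by (rule wf_repl) auto

text \<open>Each cleansing removes one \<open>c\<close>-rooted subcirquent and shrinks
  \<open>P\<close>; iterating it amounts to resolving \<open>c\<close> throughout the left
  branch.\<close>

lemma provable_cleansing_left: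
  assumes "c \<in> Cc" "wf_cirq Cd Cc P" "wf_cirq Cd Cc Q"
    and "provable Cd Cc (CConj c (resolve_conj c False P) Q)"
  shows "provable Cd Cc (CConj c P Q)"
  using assms(2,4)
proof (induction P rule: measure_induct_rule[of size])
  case (less P)
  show ?case
  proof (cases "c \<in> conj_clusters P")
    case False
    then show ?thesis using less.prems by (simp add: resolve_conj_idle)
  next
    case True
    then obtain A B where AB: "CConj c A B \<in> subs P" using exists_CConj_subs by blast
    let ?P = "repl (CConj c A B) A P"
    have "size ?P < size P" using AB by (intro size_repl_less) auto
    moreover have "wf_cirq Cd Cc ?P"
      using wf_repl_CConj[OF less.prems(1) AB, of False] by (simp only: if_True if_False)
    moreover have "resolve_conj c False ?P = resolve_conj c False P"
      using resolve_conj_repl[of c False A B P] by (simp only: if_True if_False)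
    ultimately have "provable Cd Cc (CConj c ?P Q)"
      using less.IH[of ?P] less.prems(2) by (simp only:)
    then have "provable Cd Cc (repl (CConj c P Q) (CConj c ?P Q) (CConj c P Q))" by (simp only: repl_self)
    moreover have "wf_cirq Cd Cc (CConj c P Q)" using assms(1) less.prems(1) assms(3) by simp
    ultimately show ?thesis
      using provable.cleansing1[OF _ subs_refl AB] by blast
  qed
qed

lemma provable_cleansing_right:
  assumes "c \<in> Cc" "wf_cirq Cd Cc P" "wf_cirq Cd Cc Q"
    and "provable Cd Cc (CConj c P (resolve_conj c True Q))"
  shows "provable Cd Cc (CConj c P Q)"
  using assms(3,4)
proof (induction Q rule: measure_induct_rule[of size])
  case (less Q)
  show ?case
  proof (cases "c \<in> conj_clusters Q")
    case False
    then show ?thesis using less.prems by (simp add: resolve_conj_idle)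
  next
    case True
    then obtain A B where AB: "CConj c A B \<in> subs Q" using exists_CConj_subs by blast
    let ?Q = "repl (CConj c A B) B Q"
    have "size ?Q < size Q" using AB by (intro size_repl_less) auto
    moreover have "wf_cirq Cd Cc ?Q"
      using wf_repl_CConj[OF less.prems(1) AB, of True] by (simp only: if_True if_False)
    moreover have "resolve_conj c True ?Q = resolve_conj c True Q"
      using resolve_conj_repl[of c True A B Q] by (simp only: if_True if_False)
    ultimately have "provable Cd Cc (CConj c P ?Q)"
      using less.IH[of ?Q] less.prems(2) by (simp only:)
    then have "provable Cd Cc (repl (CConj c P Q) (CConj c P ?Q) (CConj c P Q))" by (simp only: repl_self)
    moreover have "wf_cirq Cd Cc (CConj c P Q)" using assms(1) assms(2) less.prems(1) by simp
    ultimately show ?thesis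
      using provable.cleansing2[OF _ subs_refl AB] by blast
  qed
qed

lemma winnable_imp_provable:
  assumes "Cd \<inter> Cc = {}" "infinite Cc" "wf_cirq Cd Cc C" "winnable C"
  shows "provable Cd Cc C"
  using assms(3,4)
\<comment> \<open>Choosing lowers the second component, rewriting the third and splitting the first,
  and none raises a component of higher priority. Choosing can expose a heavy cirquent, so
  \<open>weight\<close> comes last.\<close>
proof (induction C rule: wf_induct_rule[OF wf_measures[of "[rank, \<lambda>C. card (disj_clusters C), weight]"]])
  case (1 C)
  note IH = "1.IH" and wf = "1.prems"(1) and win = "1.prems"(2)
  consider (choose) d b where "d \<in> disj_clusters C" "winnable (resolve_disj d b C)"
    | (taut) "\<And>I. holds I Map.empty Map.empty C"
    using winnable_cases[OF win] by blast
  then show ?case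
  proof cases
    case choose
    have "disj_clusters (resolve_disj d b C) \<subset> disj_clusters C"
      using disj_clusters_resolve_disj choose(1) by blast
    then have "card (disj_clusters (resolve_disj d b C)) < card (disj_clusters C)"
      by (simp add: psubset_card_mono)
    then have "provable Cd Cc (resolve_disj d b C)"
      using choose(2) wf rank_resolve_disj[of d b C] by (intro IH) (auto intro: wf_resolve_disj)
    then show ?thesis using exists_CDisj_subs[OF choose(1)] wf provable.choosing by blast
  next
    case taut
    show ?thesis
    proof (cases "reducible C")
      case True
      then obtain Z' E where Z': "ac_step\<^sup>*\<^sup>* C Z'" "E \<in> surface Z'" "redex E"
        unfolding reducible_def by blast
      note Z'_props = ac_steps_preserve[OF Z'(1) wf]
      obtain Z'' where Z'': "wf_cirq Cd Cc Z''" "rank Z'' \<le> rank Z'" "weight Z'' < weight Z'"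
        "disj_clusters Z'' \<subseteq> disj_clusters Z'" "winnable Z'"
        "winnable Z' \<longrightarrow> winnable Z''" "provable Cd Cc Z'' \<longrightarrow> provable Cd Cc Z'"
        using exists_reducing_step[OF _ assms(2) Z'(2,3)] Z'_props win by blast
      then have "card (disj_clusters Z'') \<le> card (disj_clusters C)"
        using Z'_props by (intro card_mono) auto
      with Z'' Z'_props have "provable Cd Cc Z''"
        by (intro IH) (auto simp: le_less)
      then show ?thesis using Z'' Z'_props by blast
    next
      case False
      from irreducible_tautology[OF this taut] show ?thesis
      proof (elim disjE exE)
        fix c P Q assume C: "C = CConj c P Q"
        have c: "c \<in> Cc" "wf_cirq Cd Cc P" "wf_cirq Cd Cc Q" using wf C by auto
        have smaller: "provable Cd Cc D" if "rank D < rank C" "wf_cirq Cd Cc D" "winnable D" for D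
          using IH[of D] that by simp
        \<comment> \<open>Splitting demands that \<open>c\<close> be absent from the branches:
          resolving removes its conjunctive occurrences, and disjointness rules out disjunctive
          ones.\<close>
        have fresh: "c \<notin> clusters (resolve_conj c b X)" if "wf_cirq Cd Cc X" for b X
          using wf_resolve_conj[OF that, of c b] conj_clusters_resolve_conj[of c b X] assms(1) c(1)
          by (auto simp: clusters_eq wf_cirq_iff)
        have "winnable (resolve_conj c False P)" "winnable (resolve_conj c True Q)"
          using winnable_resolve_conj[OF win, of c False] winnable_resolve_conj[OF win, of c True] C by auto
        then have "provable Cd Cc (resolve_conj c False P)" "provable Cd Cc (resolve_conj c True Q)"
          using c rank_resolve_conj[of c False P] rank_resolve_conj[of c True Q] C
          by (simp_all add: smaller wf_resolve_conj less_Suc_eq_le max.coboundedI1 max.coboundedI2)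
        then have "provable Cd Cc (CConj c (resolve_conj c False P) (resolve_conj c True Q))"
          using c fresh by (intro provable.splitting) (auto intro: wf_resolve_conj)
        then have "provable Cd Cc (CConj c (resolve_conj c False P) Q)"
          using c by (rule_tac provable_cleansing_right) (auto intro: wf_resolve_conj)
        then show ?thesis unfolding C using c by (rule provable_cleansing_left[rotated 3])
      qed (auto intro: provable.axiom)
    qed
  qed
qed

section \<open>Environments against machines\<close>

definition choice_move :: "string \<Rightarrow> bool \<Rightarrow> move" where
  "choice_move c b = c @ ''.'' @ [if b then CHR ''1'' else CHR ''0'']"

lemma legal_move_iff:
  "legal_move Cd Cc x \<longleftrightarrow> (\<exists>c b. x = (PT, choice_move c b) \<and> c \<in> Cd \<or> x = (PB, choice_move c b) \<and> c \<in> Cc)"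
proof
  assume "legal_move Cd Cc x"
  then obtain c i where i: "snd x = c @ ''.'' @ [i]" "i \<in> {CHR ''0'', CHR ''1''}"
    "c \<in> Cd \<and> fst x = PT \<or> c \<in> Cc \<and> fst x = PB" unfolding legal_move_def by blast
  then have "snd x = choice_move c (i = CHR ''1'')" by (auto simp: choice_move_def)
  with i(3) show "\<exists>c b. x = (PT, choice_move c b) \<and> c \<in> Cd \<or> x = (PB, choice_move c b) \<and> c \<in> Cc"
    by (metis prod.collapse)
next
  assume "\<exists>c b. x = (PT, choice_move c b) \<and> c \<in> Cd \<or> x = (PB, choice_move c b) \<and> c \<in> Cc"
  then show "legal_move Cd Cc x" unfolding legal_move_def choice_move_def by fastforce
qed

lemma move_cluster_choice_move: "CHR ''.'' \<notin> set c \<Longrightarrow> move_cluster (choice_move c b) = c"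
  unfolding move_cluster_def choice_move_def by (subst takeWhile_append2) auto

lemma move_cluster_eq: "move_cluster (choice_move c b) = move_cluster (choice_move c b')"
  unfolding move_cluster_def choice_move_def by (induction c) auto

lemma choice_move_inject [simp]: "choice_move c b = choice_move c' b' \<longleftrightarrow> c = c' \<and> b = b'"
  unfolding choice_move_def by auto

lemma decimal_numeral_no_dot: "decimal_numeral c \<Longrightarrow> CHR ''.'' \<notin> set c"
  unfolding decimal_numeral_def by auto

lemma legal_run_iff:
  "legal_run Cd Cc \<Gamma> \<longleftrightarrow>
    (\<forall>x\<in>set \<Gamma>. legal_move Cd Cc x) \<and> distinct (map (\<lambda>x. move_cluster (snd x)) \<Gamma>)"
proof -
  have "(\<forall>i j. i < j \<and> j < length \<Gamma> \<longrightarrow> move_cluster (snd (\<Gamma> ! i)) \<noteq> move_cluster (snd (\<Gamma> ! j)))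
    \<longleftrightarrow> distinct (map (\<lambda>x. move_cluster (snd x)) \<Gamma>)"
    unfolding distinct_conv_nth by (auto simp: nat_neq_iff) (metis order.strict_trans nat_neq_iff)+
  then show ?thesis unfolding legal_run_def by blast
qed

lemma legal_run_appendD: "legal_run Cd Cc (\<Gamma> @ \<Delta>) \<Longrightarrow> legal_run Cd Cc \<Gamma>"
  by (auto simp: legal_run_iff)

lemma illegal_last_eq:
  assumes "legal_run Cd Cc \<Gamma>" "\<not> legal_run Cd Cc (\<Gamma> @ [x])"
  shows "illegal_last Cd Cc (\<Gamma> @ x # \<Delta>) = x"
proof -
  have "(LEAST n. \<not> legal_run Cd Cc (take (Suc n) (\<Gamma> @ x # \<Delta>))) = length \<Gamma>"
  proof (rule Least_equality)
    fix n assume n: "\<not> legal_run Cd Cc (take (Suc n) (\<Gamma> @ x # \<Delta>))"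
    show "length \<Gamma> \<le> n"
    proof (rule ccontr)
      assume "\<not> length \<Gamma> \<le> n"
      then have "take (Suc n) (\<Gamma> @ x # \<Delta>) = take (Suc n) \<Gamma>" by simp
      moreover have "legal_run Cd Cc (take (Suc n) \<Gamma>)"
        using assms(1) legal_run_appendD by (metis append_take_drop_id)
      ultimately show False using n by simp
    qed
  qed (use assms(2) in simp)
  then show ?thesis unfolding illegal_last_def by simp
qed

lemma illegal_run_split:
  assumes "\<not> legal_run Cd Cc \<Gamma>"
  obtains \<Gamma>1 x \<Gamma>2 where "\<Gamma> = \<Gamma>1 @ x # \<Gamma>2" "legal_run Cd Cc \<Gamma>1" "\<not> legal_run Cd Cc (\<Gamma>1 @ [x])"
  using assms
proof (induction \<Gamma> arbitrary: thesis rule: rev_induct)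
  case (snoc x \<Gamma>)
  show ?case
  proof (cases "legal_run Cd Cc \<Gamma>")
    case True
    then show ?thesis using snoc.prems by blast
  next
    case False
    show ?thesis by (rule snoc.IH[OF _ False]) (use snoc.prems(1) in simp)
  qed
qed (simp add: legal_run_iff)

text \<open>Legality expressed for a set of labelled moves, so that it also applies to the limit of
  an infinite run.\<close>

definition consistent :: "string set \<Rightarrow> string set \<Rightarrow> lmove set \<Rightarrow> bool" where
  "consistent Cd Cc S \<longleftrightarrow> (\<forall>x\<in>S. legal_move Cd Cc x) \<and>
     (\<forall>x\<in>S. \<forall>y\<in>S. move_cluster (snd x) = move_cluster (snd y) \<longrightarrow> x = y)"

definition choices :: "lmove set \<Rightarrow> string \<Rightarrow> bool option" where
  "choices S c = (if chosen S c (CHR ''0'') then Some False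
     else if chosen S c (CHR ''1'') then Some True else None)"

lemma chosen_iff:
  "chosen S c (CHR ''0'') \<longleftrightarrow> (\<exists>p. (p, choice_move c False) \<in> S)"
  "chosen S c (CHR ''1'') \<longleftrightarrow> (\<exists>p. (p, choice_move c True) \<in> S)"
  by (auto simp: chosen_def choice_move_def)

lemma consistent_not_both:
  assumes "consistent Cd Cc S" "(p, choice_move c b) \<in> S" shows "(q, choice_move c (\<not> b)) \<notin> S"
proof
  assume q: "(q, choice_move c (\<not> b)) \<in> S"
  have "(p, choice_move c b) = (q, choice_move c (\<not> b))"
    using assms q move_cluster_eq[of c b "\<not> b"] unfolding consistent_def by fastforce
  then show False by simp
qed

lemma choices_eq:
  assumes "consistent Cd Cc S" "(p, choice_move c b) \<in> S" shows "choices S c = Some b"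
  using assms consistent_not_both[OF assms] unfolding choices_def chosen_iff by (cases b) auto

lemma win_leg_holds:
  assumes "consistent Cd Cc S"
  shows "win_leg I S C = holds I (choices S) (choices S) C"
proof -
  have "\<not> (chosen S c (CHR ''0'') \<and> chosen S c (CHR ''1''))" for c
    unfolding chosen_iff using consistent_not_both[OF assms, of _ c False] by auto
  then show ?thesis by (induction C) (auto simp: choices_def)
qed

lemma legal_run_consistent:
  assumes "legal_run Cd Cc \<Gamma>" shows "consistent Cd Cc (set \<Gamma>)"
  using assms unfolding consistent_def legal_run_iff by (auto simp: distinct_map dest: inj_onD)

lemma consistent_Union:
  assumes "\<And>t. consistent Cd Cc (S t)" "\<And>t. S t \<subseteq> S (Suc t)"
  shows "consistent Cd Cc (\<Union>t. S t)"
proof -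
  have mono: "S t \<subseteq> S (max t s)" "S s \<subseteq> S (max t s)" for t s
    using lift_Suc_mono_le[of S, OF assms(2)] by simp_all
  show ?thesis unfolding consistent_def
  proof (intro conjI ballI impI)
    fix x y assume "x \<in> (\<Union>t. S t)" "y \<in> (\<Union>t. S t)" "move_cluster (snd x) = move_cluster (snd y)"
    then obtain t s where "x \<in> S (max t s)" "y \<in> S (max t s)" using mono by blast
    then show "x = y" using assms(1)[of "max t s"] \<open>move_cluster (snd x) = _\<close> unfolding consistent_def by blast
  qed (use assms(1) in \<open>auto simp: consistent_def\<close>)
qed

text \<open>A semantic relation: moves may be taken into account in any order, and nothing is
  claimed when no consistent set contains \<open>M\<close>, for instance after an illegal
  move.\<close>

definition residue :: "string set \<Rightarrow> string set \<Rightarrow> lmove set \<Rightarrow> cirq \<Rightarrow> cirq \<Rightarrow> bool" where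
  "residue Cd Cc M C C' \<longleftrightarrow> (\<forall>S I. consistent Cd Cc S \<longrightarrow> M \<subseteq> S \<longrightarrow>
     holds I (choices S) (choices S) C = holds I (choices S) (choices S) C')"

lemma residue_refl [simp]: "residue Cd Cc M C C"
  by (simp add: residue_def)

lemma residue_mono: "residue Cd Cc M C C' \<Longrightarrow> M \<subseteq> N \<Longrightarrow> residue Cd Cc N C C'"
  unfolding residue_def by blast

lemma residue_resolve:
  assumes "residue Cd Cc M C C'" "(p, choice_move c b) \<in> M"
  shows "residue Cd Cc M C (resolve_disj c b C')" "residue Cd Cc M C (resolve_conj c b C')"
  using assms choices_eq[of Cd Cc _ p c b]
  unfolding residue_def by (metis holds_resolve_disj subsetD, metis holds_resolve_conj subsetD)

section \<open>Generated runs and the environment that defeats an HPM\<close>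

lemma gen_run_0 [simp]: "gen_run \<delta> e 0 = []"
  by (simp add: gen_run_def)

lemma gen_run_Suc:
  "\<exists>ms. gen_run \<delta> e (Suc t) = gen_run \<delta> e t @ map (Pair PB) (e t) @ ms \<and> (ms = [] \<or> (\<exists>m. ms = [(PT, m)]))"
  by (cases "hpm_conf \<delta> e t")
    (auto simp: gen_run_def hpm_step_def Let_def split: prod.splits)

lemma gen_run_le: "t \<le> s \<Longrightarrow> \<exists>\<Delta>. gen_run \<delta> e s = gen_run \<delta> e t @ \<Delta>"
proof (induction s)
  case (Suc s)
  then show ?case using gen_run_Suc[of \<delta> e s] by (cases "t = Suc s") auto
qed simp

lemma hpm_conf_cong: "(\<And>s. s < t \<Longrightarrow> e s = e' s) \<Longrightarrow> hpm_conf \<delta> e t = hpm_conf \<delta> e' t"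
  by (induction t) auto

lemma gen_run_cong: "(\<And>s. s < t \<Longrightarrow> e s = e' s) \<Longrightarrow> gen_run \<delta> e t = gen_run \<delta> e' t"
  unfolding gen_run_def by (metis hpm_conf_cong)

lemma gen_run_consistent:
  assumes "\<And>t. legal_run Cd Cc (gen_run \<delta> e t)" shows "consistent Cd Cc (\<Union>t. set (gen_run \<delta> e t))"
proof (rule consistent_Union)
  show "set (gen_run \<delta> e t) \<subseteq> set (gen_run \<delta> e (Suc t))" for t
    using gen_run_le[of t "Suc t" \<delta> e] by auto
qed (use assms in \<open>rule legal_run_consistent\<close>)

text \<open>Every illegal stage of the run has the same shortest illegal initial segment, so the
  blame cannot pass to the environment.\<close>

lemma illegal_machine_move_loses:
  assumes "gen_run \<delta> e (Suc s) = \<Gamma> @ [(PT, m)]" "legal_run Cd Cc \<Gamma>" "legal_run Cd Cc (gen_run \<delta> e s)"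
    and "\<not> legal_run Cd Cc (gen_run \<delta> e (Suc s))"
  shows "\<not> top_wins Cd Cc I C (gen_run \<delta> e)"
proof -
  have "illegal_last Cd Cc (gen_run \<delta> e t) = (PT, m)" if "\<not> legal_run Cd Cc (gen_run \<delta> e t)" for t
  proof -
    have "\<not> t \<le> s" using that assms(3) gen_run_le legal_run_appendD by metis
    then obtain \<Delta> where "gen_run \<delta> e t = \<Gamma> @ (PT, m) # \<Delta>"
      using gen_run_le[of "Suc s" t \<delta> e] assms(1) by auto
    then show ?thesis using illegal_last_eq assms by metis
  qed
  then show ?thesis using assms(4) unfolding top_wins_def by auto
qed

locale cluster_names =
  fixes Cd Cc :: "string set"
  assumes disjoint: "Cd \<inter> Cc = {}"
    and no_dot: "\<And>c. c \<in> Cd \<union> Cc \<Longrightarrow> CHR ''.'' \<notin> set c"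
begin

definition position :: "cirq \<Rightarrow> lmove list \<Rightarrow> cirq \<Rightarrow> bool" where
  "position C \<Gamma> C' \<longleftrightarrow> legal_run Cd Cc \<Gamma> \<and> wf_cirq Cd Cc C' \<and>
     (\<forall>x\<in>set \<Gamma>. move_cluster (snd x) \<notin> clusters C') \<and> residue Cd Cc (set \<Gamma>) C C'"

lemma move_cluster_choice [simp]: "c \<in> Cd \<union> Cc \<Longrightarrow> move_cluster (choice_move c b) = c"
  using no_dot move_cluster_choice_move by blast

lemma position_irrelevant:
  assumes "position C \<Gamma> C'" "legal_run Cd Cc (\<Gamma> @ [x])" "move_cluster (snd x) \<notin> clusters C'"
  shows "position C (\<Gamma> @ [x]) C'"
  using assms unfolding position_def by (auto intro: residue_mono)

lemma position_PT:
  assumes "position C \<Gamma> C'" "legal_run Cd Cc (\<Gamma> @ [(PT, choice_move d b)])" "d \<in> Cd"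
  shows "position C (\<Gamma> @ [(PT, choice_move d b)]) (resolve_disj d b C')"
proof -
  let ?\<Gamma> = "\<Gamma> @ [(PT, choice_move d b)]"
  have wf: "wf_cirq Cd Cc C'" using assms(1) unfolding position_def by blast
  have "clusters (resolve_disj d b C') \<subseteq> clusters C' - {d}"
    using disj_clusters_resolve_disj[of d b C'] conj_clusters_resolve_disj[of d b C'] wf assms(3) disjoint
    unfolding clusters_eq wf_cirq_iff by blast
  then have "\<forall>x\<in>set ?\<Gamma>. move_cluster (snd x) \<notin> clusters (resolve_disj d b C')"
    using assms(1,3) unfolding position_def by auto
  moreover have "residue Cd Cc (set ?\<Gamma>) C C'"
    using assms(1) unfolding position_def by (auto intro: residue_mono)
  then have "residue Cd Cc (set ?\<Gamma>) C (resolve_disj d b C')"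
    by (rule residue_resolve(1)[where p = PT]) simp
  ultimately show ?thesis using assms(2) wf_resolve_disj[OF wf] unfolding position_def by blast
qed

lemma position_PB:
  assumes "position C \<Gamma> C'" "legal_run Cd Cc (\<Gamma> @ [(PB, choice_move c b)])" "c \<in> Cc"
  shows "position C (\<Gamma> @ [(PB, choice_move c b)]) (resolve_conj c b C')"
proof -
  let ?\<Gamma> = "\<Gamma> @ [(PB, choice_move c b)]"
  have wf: "wf_cirq Cd Cc C'" using assms(1) unfolding position_def by blast
  have "clusters (resolve_conj c b C') \<subseteq> clusters C' - {c}"
    using disj_clusters_resolve_conj[of c b C'] conj_clusters_resolve_conj[of c b C'] wf assms(3) disjoint
    unfolding clusters_eq wf_cirq_iff by blast
  then have "\<forall>x\<in>set ?\<Gamma>. move_cluster (snd x) \<notin> clusters (resolve_conj c b C')"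
    using assms(1,3) unfolding position_def by auto
  moreover have "residue Cd Cc (set ?\<Gamma>) C C'"
    using assms(1) unfolding position_def by (auto intro: residue_mono)
  then have "residue Cd Cc (set ?\<Gamma>) C (resolve_conj c b C')"
    by (rule residue_resolve(2)[where p = PB]) simp
  ultimately show ?thesis using assms(2) wf_resolve_conj[OF wf] unfolding position_def by blast
qed

text \<open>A legal machine move is either irrelevant to \<open>C'\<close> or resolves one of its
  clusters, and resolving cannot turn a lost cirquent into a winnable one.\<close>

lemma machine_response:
  assumes "position C \<Gamma> C'" "\<not> winnable C'" "ms = [] \<or> (\<exists>m. ms = [(PT, m)])" "legal_run Cd Cc (\<Gamma> @ ms)"
  obtains C'' where "position C (\<Gamma> @ ms) C''" "\<not> winnable C''"
    "C'' = C' \<or> clusters C'' \<subset> clusters C'"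
proof (cases "ms = []")
  case True
  then show ?thesis using assms that by auto
next
  case False
  then obtain m where "ms = [(PT, m)]" using assms(3) by blast
  then obtain d b where d: "ms = [(PT, choice_move d b)]" "d \<in> Cd"
    using assms(4) unfolding legal_run_iff by (auto simp: legal_move_iff)
  show ?thesis
  proof (cases "d \<in> clusters C'")
    case True
    have "wf_cirq Cd Cc C'" using assms(1) unfolding position_def by blast
    then have "clusters (resolve_disj d b C') \<subset> clusters C'"
      using disj_clusters_resolve_disj[of d b C'] conj_clusters_resolve_disj[of d b C'] d(2) disjoint True
      unfolding clusters_eq wf_cirq_iff by blast
    then show ?thesis
      using that[of "resolve_disj d b C'"] position_PT[OF assms(1), of d b] d assms(2,4) winnable_resolve_disjD
      by blast
  next
    case False
    then show ?thesis using that[of C'] position_irrelevant[OF assms(1), of "(PT, choice_move d b)"] d assms by auto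
  qed
qed

text \<open>The run up to time \<open>t\<close> depends only on the schedule before
  \<open>t\<close>, so the environment can be built in stages, adapted to \<open>\<delta>\<close>.
  The induction is on the number of clusters still open.\<close>

lemma environment_beats:
  assumes "position C (gen_run \<delta> e t) C'" "\<not> winnable C'"
  shows "\<exists>e' I. (\<forall>s<t. e' s = e s) \<and> \<not> top_wins Cd Cc I C (gen_run \<delta> e')"
  using assms
proof (induction "card (clusters C')" arbitrary: C' e t rule: less_induct)
  case less
  have IH: "\<exists>e'' I. (\<forall>s<t'. e'' s = e' s) \<and> \<not> top_wins Cd Cc I C (gen_run \<delta> e'')"
    if "position C (gen_run \<delta> e' t') C''" "\<not> winnable C''" "clusters C'' \<subset> clusters C'" for e' t' C''
    using less.hyps[OF _ that(1,2)] that(3) by (simp add: psubset_card_mono)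
  have pos: "legal_run Cd Cc (gen_run \<delta> e t)" "wf_cirq Cd Cc C'"
    "\<And>x. x \<in> set (gen_run \<delta> e t) \<Longrightarrow> move_cluster (snd x) \<notin> clusters C'"
    using less.prems(1) unfolding position_def by blast+
  have sub: "clusters C' \<subseteq> Cd \<union> Cc" using pos(2) unfolding wf_cirq_iff clusters_eq by blast
  show ?case
  proof (cases "\<forall>I. holds I Map.empty Map.empty C'")
    case True
    \<comment> \<open>By contraposition of \<open>winnable_conjI\<close> some environment choice
      keeps the position lost; it is played at time \<open>t\<close>.\<close>
    then obtain c b where c: "c \<in> conj_clusters C'" "\<not> winnable (resolve_conj c b C')"
      using winnable_conjI less.prems(2) by blast
    then have cCc: "c \<in> Cc" using pos(2) unfolding wf_cirq_iff by blast
    define e1 where "e1 s = (if s < t then e s else if s = t then [choice_move c b] else [])" for s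
    let ?x = "(PB, choice_move c b)"
    have run_t: "gen_run \<delta> e1 t = gen_run \<delta> e t" by (rule gen_run_cong) (simp add: e1_def)
    have "c \<in> clusters C'" using c(1) clusters_eq by blast
    then have "c \<notin> (\<lambda>x. move_cluster (snd x)) ` set (gen_run \<delta> e t)" using pos(3) by blast
    then have legal: "legal_run Cd Cc (gen_run \<delta> e t @ [?x])"
      using pos(1) cCc unfolding legal_run_iff by (auto simp: legal_move_iff)
    have pos1: "position C (gen_run \<delta> e t @ [?x]) (resolve_conj c b C')"
      using position_PB[OF less.prems(1) legal cCc] .
    have small: "clusters (resolve_conj c b C') \<subset> clusters C'"
      using disj_clusters_resolve_conj[of c b C'] conj_clusters_resolve_conj[of c b C'] cCc disjoint
        \<open>c \<in> clusters C'\<close> pos(2) unfolding clusters_eq wf_cirq_iff by blast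
    obtain ms where ms: "gen_run \<delta> e1 (Suc t) = (gen_run \<delta> e t @ [?x]) @ ms"
      "ms = [] \<or> (\<exists>m. ms = [(PT, m)])"
      using gen_run_Suc[of \<delta> e1 t] run_t by (auto simp: e1_def)
    show ?thesis
    proof (cases "legal_run Cd Cc ((gen_run \<delta> e t @ [?x]) @ ms)")
      case True
      from machine_response[OF pos1 c(2) ms(2) True] obtain C'' where
        "position C (gen_run \<delta> e1 (Suc t)) C''" "\<not> winnable C''" "clusters C'' \<subset> clusters C'"
        using ms(1) small by (metis order.strict_trans)
      from IH[OF this] obtain e' I where "\<forall>s<Suc t. e' s = e1 s" "\<not> top_wins Cd Cc I C (gen_run \<delta> e')"
        by blast
      then show ?thesis by (intro exI[of _ e'] exI[of _ I]) (simp add: e1_def)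
    next
      case False
      with ms(2) legal obtain m where "ms = [(PT, m)]" by auto
      then have "\<not> top_wins Cd Cc I C (gen_run \<delta> e1)" for I
        using illegal_machine_move_loses[OF _ legal, of \<delta> e1 t m] False ms(1) run_t pos(1) by simp
      then show ?thesis by (intro exI[of _ e1]) (auto simp: e1_def)
    qed
  next
    case False
    then obtain I where I: "\<not> holds I Map.empty Map.empty C'" by blast
    define e1 where "e1 s = (if s < t then e s else [])" for s
    have run_t: "gen_run \<delta> e1 t = gen_run \<delta> e t" by (rule gen_run_cong) (simp add: e1_def)
    show ?thesis
    \<comment> \<open>Here silence is the plan. A relevant machine move would shrink the clusters
      and hand over to the induction hypothesis, and an illegal one loses; so the position stays
      \<open>C'\<close> for ever, and \<open>I\<close> falsifies it.\<close>
    proof (rule ccontr)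
      assume contra: "\<not> ?thesis"
      moreover have "\<forall>s<t. e1 s = e s" by (simp add: e1_def)
      ultimately have e1_wins: "top_wins Cd Cc J C (gen_run \<delta> e1)" for J by blast
      have stay: "position C (gen_run \<delta> e1 (t + k)) C'" for k
      proof (induction k)
        case 0
        then show ?case using less.prems(1) run_t by simp
      next
        case (Suc k)
        have legal: "legal_run Cd Cc (gen_run \<delta> e1 (t + k))" using Suc unfolding position_def by blast
        obtain ms where ms: "gen_run \<delta> e1 (Suc (t + k)) = gen_run \<delta> e1 (t + k) @ ms"
          "ms = [] \<or> (\<exists>m. ms = [(PT, m)])"
          using gen_run_Suc[of \<delta> e1 "t + k"] by (auto simp: e1_def)
        have "legal_run Cd Cc (gen_run \<delta> e1 (t + k) @ ms)"
        proof (rule ccontr)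
          assume illegal: "\<not> ?thesis"
          with ms(2) legal obtain m where "ms = [(PT, m)]" by auto
          then show False
            using illegal_machine_move_loses[OF _ legal legal, of m] illegal ms(1) e1_wins by simp
        qed
        from machine_response[OF Suc less.prems(2) ms(2) this] obtain C'' where C'':
          "position C (gen_run \<delta> e1 (t + Suc k)) C''" "\<not> winnable C''" "C'' = C' \<or> clusters C'' \<subset> clusters C'"
          using ms(1) by auto
        moreover have False if "clusters C'' \<subset> clusters C'"
        proof -
          from IH[OF C''(1,2) that] obtain e' J where "\<forall>s<t + Suc k. e' s = e1 s"
            "\<not> top_wins Cd Cc J C (gen_run \<delta> e')" by blast
          then have "\<forall>s<t. e' s = e s" by (simp add: e1_def)
          then show False using contra \<open>\<not> top_wins Cd Cc J C (gen_run \<delta> e')\<close> by blast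
        qed
        ultimately show ?case by blast
      qed
      let ?S = "\<Union>s. set (gen_run \<delta> e1 s)"
      have in_later: "\<exists>\<Delta>. gen_run \<delta> e1 (t + s) = gen_run \<delta> e1 s @ \<Delta>" for s
        by (rule gen_run_le) simp
      have legal: "legal_run Cd Cc (gen_run \<delta> e1 s)" for s
        using stay[of s] in_later[of s] legal_run_appendD unfolding position_def by metis
      then have cons: "consistent Cd Cc ?S" by (rule gen_run_consistent)
      have "choices ?S c = None" if "c \<in> clusters C'" for c
      proof -
        have "(p, choice_move c b) \<notin> set (gen_run \<delta> e1 s)" for p b s
        proof
          assume "(p, choice_move c b) \<in> set (gen_run \<delta> e1 s)"
          then have "(p, choice_move c b) \<in> set (gen_run \<delta> e1 (t + s))" using in_later[of s] by auto
          then have "move_cluster (choice_move c b) \<notin> clusters C'"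
            using stay[of s] unfolding position_def by force
          then show False using that sub by auto
        qed
        then show ?thesis unfolding choices_def chosen_iff by auto
      qed
      then have "holds I (choices ?S) (choices ?S) C' = holds I Map.empty Map.empty C'"
        by (intro holds_cong) (auto simp: clusters_eq)
      moreover have "holds I (choices ?S) (choices ?S) C = holds I (choices ?S) (choices ?S) C'"
        using stay[of 0] cons unfolding position_def residue_def by blast
      ultimately have "\<not> win_leg I ?S C" using I win_leg_holds[OF cons] by simp
      then show False using e1_wins[of I] legal unfolding top_wins_def by simp
    qed
  qed
qed

lemma valid_imp_winnable:
  assumes "wf_cirq Cd Cc C" "valid Cd Cc C" shows "winnable C"
proof (rule ccontr)
  assume not: "\<not> winnable C"
  obtain \<delta> where \<delta>: "\<And>I e. top_wins Cd Cc I C (gen_run \<delta> e)"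
    using assms(2) unfolding valid_def solves_def by blast
  have "position C (gen_run \<delta> (\<lambda>_. []) 0) C"
    using assms(1) unfolding position_def by (simp add: legal_run_iff)
  from environment_beats[OF this not] show False using \<delta> by blast
qed

end

section \<open>Playing a strategy by an HPM\<close>

text \<open>An over-approximation of what resolving can produce (different occurrences of a cluster
  may be treated differently), finite and closed under resolving.\<close>

primrec residuals :: "cirq \<Rightarrow> cirq set" where
  "residuals CTop = {CTop}"
| "residuals CBot = {CBot}"
| "residuals (Lit p) = {Lit p}"
| "residuals (NLit p) = {NLit p}"
| "residuals (Disj A B) = {Disj X Y |X Y. X \<in> residuals A \<and> Y \<in> residuals B}"
| "residuals (Conj A B) = {Conj X Y |X Y. X \<in> residuals A \<and> Y \<in> residuals B}"
| "residuals (CDisj c A B) = {CDisj c X Y |X Y. X \<in> residuals A \<and> Y \<in> residuals B} \<union> residuals A \<union> residuals B"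
| "residuals (CConj c A B) = {CConj c X Y |X Y. X \<in> residuals A \<and> Y \<in> residuals B} \<union> residuals A \<union> residuals B"

lemma finite_residuals [simp]: "finite (residuals C)"
  by (induction C) (auto intro: finite_image_set2)

lemma residuals_refl [simp]: "C \<in> residuals C"
  by (induction C) auto

lemma resolve_disj_residuals: "X \<in> residuals C \<Longrightarrow> resolve_disj d b X \<in> residuals C"
  by (induction C arbitrary: X) (auto, blast+)

lemma resolve_conj_residuals: "X \<in> residuals C \<Longrightarrow> resolve_conj d b X \<in> residuals C"
  by (induction C arbitrary: X) (auto, blast+)

lemma clusters_residuals: "X \<in> residuals C \<Longrightarrow> clusters X \<subseteq> clusters C"
  by (induction C arbitrary: X) (auto, blast+)

text \<open>The tape alphabet is infinite because of \<open>Aux\<close>, so \<open>is_hpm\<close>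
  does not follow from \<open>Q\<close> alone; \<open>W\<close> bounds the written symbols. The
  guard sends everything that would leave \<open>Q\<close> to a dummy value, since the inverse of
  \<open>enc\<close> is arbitrary outside its image.\<close>

lemma finite_control_machine:
  fixes tr :: "'q \<Rightarrow> sym \<Rightarrow> sym \<Rightarrow> 'q \<times> sym \<times> dir \<times> dir \<times> bool"
  assumes "finite Q" "finite W" "\<And>q a b. fst (snd (tr q a b)) \<in> W"
  obtains \<delta> enc where "is_hpm \<delta>" "enc q0 = (0 :: nat)"
    "\<And>q a b. q \<in> Q \<Longrightarrow> fst (tr q a b) \<in> Q \<Longrightarrow> \<delta> (enc q, a, b) = (enc (fst (tr q a b)), snd (tr q a b))"
proof -
  obtain f :: "'q \<Rightarrow> nat" where f: "inj_on f Q"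
    using finite_imp_inj_to_nat_seg[OF assms(1)] by blast
  define enc where "enc q = (if q = q0 then 0 else Suc (f q))" for q
  have inj: "inj_on enc Q" using f by (auto simp: inj_on_def enc_def)
  define \<delta> :: hpm where "\<delta> x = (case x of (n, a, b) \<Rightarrow>
      let y = tr (the_inv_into Q enc n) a b in
      if fst y \<in> Q then (enc (fst y), snd y) else (0, Blank, DS, DS, False))" for x
  have "UNIV = {DL, DR, DS}" using dir.exhaust by auto
  then have "finite (UNIV :: dir set)" by (metis finite.intros)
  then have "finite (insert (0, Blank, DS, DS, False) (enc ` Q \<times> W \<times> (UNIV :: dir set) \<times> (UNIV :: dir set) \<times> (UNIV :: bool set)))"
    using assms(1,2) by (intro finite.insertI finite_cartesian_product) auto
  moreover have "\<delta> x \<in> insert (0, Blank, DS, DS, False) (enc ` Q \<times> W \<times> UNIV \<times> UNIV \<times> UNIV)" for x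
  proof -
    obtain n a b where x: "x = (n, a, b)" by (cases x)
    let ?y = "tr (the_inv_into Q enc n) a b"
    have "fst (snd ?y) \<in> W" by (rule assms(3))
    then have "snd ?y \<in> W \<times> UNIV \<times> UNIV \<times> UNIV" by (cases "snd ?y") auto
    then show ?thesis by (simp add: \<delta>_def x Let_def mem_Times_iff)
  qed
  ultimately have "is_hpm \<delta>" unfolding is_hpm_def by (meson finite_subset image_subsetI)
  moreover have "\<delta> (enc q, a, b) = (enc (fst (tr q a b)), snd (tr q a b))"
    if "q \<in> Q" "fst (tr q a b) \<in> Q" for q a b
    using that inj by (simp add: \<delta>_def the_inv_into_f_f Let_def)
  moreover have "enc q0 = 0" by (simp add: enc_def)
  ultimately show ?thesis using that by blast
qed

section \<open>Encoded runs and the reading buffer\<close>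

lemma enc_run_append: "enc_run (\<Gamma> @ \<Delta>) = enc_run \<Gamma> @ enc_run \<Delta>"
  by (simp add: enc_run_def)

lemma enc_run_Cons: "enc_run ((p, m) # \<Gamma>) = (if p = PT then Aux 0 else Aux 1) # map Ch m @ enc_run \<Gamma>"
  by (simp add: enc_run_def)

lemma enc_run_Nil [simp]: "enc_run [] = []"
  by (simp add: enc_run_def)

lemma Blank_notin_enc_run: "Blank \<notin> set (enc_run \<Gamma>)"
  by (auto simp: enc_run_def)

lemma tape_move_0 [simp]: "tape_move w 0 = []"
  by (simp add: tape_move_def)

lemma tape_move_write: "tape_move (w(k := Ch x)) (Suc k) = tape_move w k @ [x]"
proof -
  have "tape_move (w(k := Ch x)) k = tape_move w k"
    unfolding tape_move_def by (intro arg_cong[where f = concat] map_cong) auto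
  then show ?thesis by (simp add: tape_move_def)
qed

text \<open>The buffer holds the part of the current move read so far, truncated at \<open>N\<close> symbols.\<close>

definition push :: "nat \<Rightarrow> sym list \<Rightarrow> sym \<Rightarrow> sym list" where
  "push N buf x = (case x of Blank \<Rightarrow> buf | Ch _ \<Rightarrow> take N (buf @ [x]) | Aux n \<Rightarrow> [Aux (min n 1)])"

definition buffer :: "nat \<Rightarrow> sym list \<Rightarrow> sym list" where
  "buffer N xs = foldl (push N) [] xs"

lemma buffer_Nil [simp]: "buffer N [] = []"
  by (simp add: buffer_def)

lemma buffer_snoc: "buffer N (xs @ [x]) = push N (buffer N xs) x"
  by (simp add: buffer_def)

lemma buffer_bounded:
  assumes "1 \<le> N"
  shows "length (buffer N xs) \<le> N \<and> set (buffer N xs) \<subseteq> insert (Aux 0) (insert (Aux 1) (range Ch))"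
proof (induction xs rule: rev_induct)
  case (snoc x xs)
  then show ?case
    using assms set_take_subset[of N "buffer N xs @ [x]"]
    by (cases x) (auto simp: buffer_snoc push_def min_def)
qed simp

lemma buffer_move:
  assumes "1 \<le> N"
  shows "buffer N (xs @ Aux a # map Ch m) = take N (Aux (min a 1) # map Ch m)"
proof (induction m rule: rev_induct)
  case Nil
  show ?case using buffer_snoc[of N xs "Aux a"] assms by (cases N) (auto simp: push_def)
next
  case (snoc c m)
  have "buffer N (xs @ Aux a # map Ch (m @ [c])) = push N (buffer N (xs @ Aux a # map Ch m)) (Ch c)"
    using buffer_snoc[of N "xs @ Aux a # map Ch m" "Ch c"] by simp
  also have "\<dots> = take N (Aux (min a 1) # map Ch (m @ [c]))"
    using assms unfolding snoc by (cases N) (auto simp: push_def min_def)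
  finally show ?case .
qed

text \<open>\<open>Aux 1\<close> stems only from the label of an environment move, and a buffer
  shorter than \<open>N\<close> has lost nothing to truncation. The move may continue beyond
  \<open>w\<close>, as the head can stand inside it.\<close>

lemma buffer_prefix:
  assumes "1 \<le> N" "length w < N - 1" "buffer N (take j (enc_run \<Gamma>)) = Aux 1 # map Ch w"
  shows "\<exists>m. (PB, w @ m) \<in> set \<Gamma>"
  using assms(3)
proof (induction \<Gamma> arbitrary: j rule: rev_induct)
  case (snoc x \<Gamma>)
  obtain p m where x: "x = (p, m)" by (cases x)
  show ?case
  proof (cases "j \<le> length (enc_run \<Gamma>)")
    case True
    then show ?thesis using snoc by (auto simp: enc_run_append)
  next
    case False
    then obtain i where i: "j = Suc (length (enc_run \<Gamma>) + i)" using less_natE by (metis linorder_not_le)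
    let ?a = "if p = PT then 0 else 1 :: nat"
    have "take j (enc_run (\<Gamma> @ [x])) = enc_run \<Gamma> @ Aux ?a # map Ch (take i m)"
      by (simp add: enc_run_append enc_run_Cons x i take_map)
    then have eq: "take N (Aux ?a # map Ch (take i m)) = Aux 1 # map Ch w"
      using snoc.prems buffer_move[OF assms(1), of "enc_run \<Gamma>" ?a "take i m"] by (simp split: if_splits)
    then have "length (take N (Aux ?a # map Ch (take i m))) < N" using assms(2) by simp
    then have "Aux ?a # map Ch (take i m) = Aux 1 # map Ch w" using eq by (metis length_take min_less_iff_conj not_less take_all_iff nless_le linorder_not_le)
    then have "p = PB" "take i m = w" by (auto split: if_splits dest: map_injective simp: inj_on_def) (use player.exhaust in blast)
    then show ?thesis using x by (metis append_take_drop_id in_set_conv_decomp)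
  qed
qed simp

section \<open>The machine that plays the strategy\<close>

definition next_choice :: "cirq \<Rightarrow> (string \<times> bool) option" where
  "next_choice X = (if \<exists>x. fst x \<in> disj_clusters X \<and> winnable (resolve_disj (fst x) (snd x) X)
     then Some (SOME x. fst x \<in> disj_clusters X \<and> winnable (resolve_disj (fst x) (snd x) X)) else None)"

lemma next_choice_Some:
  assumes "next_choice X = Some (d, b)" shows "d \<in> disj_clusters X" "winnable (resolve_disj d b X)"
proof -
  let ?P = "\<lambda>x. fst x \<in> disj_clusters X \<and> winnable (resolve_disj (fst x) (snd x) X)"
  have ex: "\<exists>x. ?P x" and eq: "(SOME x. ?P x) = (d, b)"
    using assms unfolding next_choice_def by (auto split: if_splits)
  have "?P (SOME x. ?P x)" using ex by (rule someI_ex)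
  with eq show "d \<in> disj_clusters X" "winnable (resolve_disj d b X)" by auto
qed

lemma next_choice_None:
  assumes "next_choice X = None" "winnable X" shows "holds I Map.empty Map.empty X"
proof -
  have "\<not> (\<exists>x. fst x \<in> disj_clusters X \<and> winnable (resolve_disj (fst x) (snd x) X))"
    using assms(1) unfolding next_choice_def by (auto split: if_splits)
  then show ?thesis using winnable_cases[OF assms(2)] by auto
qed

abbreviation env_word :: "string \<Rightarrow> bool \<Rightarrow> sym list" where
  "env_word c b \<equiv> Aux 1 # map Ch (choice_move c b)"

lemma env_word_inject: "env_word c b = env_word c' b' \<longleftrightarrow> c = c' \<and> b = b'"
  by (auto simp: inj_map_eq_map inj_def)

definition absorb :: "sym list \<Rightarrow> cirq \<Rightarrow> cirq" where
  "absorb buf X = (if \<exists>c b. c \<in> conj_clusters X \<and> buf = env_word c b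
     then (let x = SOME x. buf = env_word (fst x) (snd x) in resolve_conj (fst x) (snd x) X) else X)"

lemma absorb_env_word: "c \<in> conj_clusters X \<Longrightarrow> absorb (env_word c b) X = resolve_conj c b X"
proof -
  assume c: "c \<in> conj_clusters X"
  have "(SOME x. env_word c b = env_word (fst x) (snd x)) = (c, b)"
    by (rule some_equality) (simp_all only: env_word_inject prod_eq_iff fst_conv snd_conv simp_thms)
  then show ?thesis using c unfolding absorb_def by auto
qed

lemma absorb_cases:
  obtains "absorb buf X = X" "\<And>c b. buf = env_word c b \<Longrightarrow> c \<notin> conj_clusters X"
  | c b where "c \<in> conj_clusters X" "buf = env_word c b" "absorb buf X = resolve_conj c b X"
proof (cases "\<exists>c b. c \<in> conj_clusters X \<and> buf = env_word c b")
  case True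
  then show ?thesis using that(2) absorb_env_word by blast
next
  case False
  then have "absorb buf X = X" unfolding absorb_def by (rule if_not_P)
  then show ?thesis using that(1) False by blast
qed

text \<open>A state consists of the residual cirquent, a flag telling that the work head is returning to
  the left end of the tape, the position of the work head, and the buffer.  In any
  non-returning state with a pending choice the machine is writing that choice.\<close>

type_synonym mstate = "cirq \<times> bool \<times> nat \<times> sym list"

text \<open>The flag is raised together with the last character because \<open>tape_move\<close> is
  evaluated after writing and moving. Leftover symbols are harmless: only cells left of the head
  count, and these are rewritten for each move. Rewinding ends on reaching cell 0, hence the new
  flag \<open>1 < k\<close>.\<close>

fun transition :: "nat \<Rightarrow> mstate \<Rightarrow> sym \<Rightarrow> sym \<Rightarrow> mstate \<times> sym \<times> dir \<times> dir \<times> bool" where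
  "transition N (X, ret, k, buf) a s =
     (if ret then ((X, 1 < k, k - 1, buf), Blank, DL, DS, False)
      else case next_choice X of
        Some (d, b) \<Rightarrow>
          if Suc k = length (choice_move d b)
          then ((resolve_disj d b X, True, Suc k, buf), Ch (choice_move d b ! k), DR, DS, True)
          else ((X, False, Suc k, buf), Ch (choice_move d b ! k), DR, DS, False)
      | None \<Rightarrow>
          if s = Blank then ((X, False, k, buf), Blank, DS, DS, False)
          else ((absorb (push N buf s) X, False, k, push N buf s), Blank, DS, DR, False))"

type_synonym mconfig = "mstate \<times> (nat \<Rightarrow> sym) \<times> nat \<times> nat \<times> lmove list"

definition mstep :: "nat \<Rightarrow> move list \<Rightarrow> mconfig \<Rightarrow> mconfig" where
  "mstep N em cfg = (case cfg of (q, w, wh, rh, \<Gamma>) \<Rightarrow>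
     let \<Gamma>1 = \<Gamma> @ map (Pair PB) em;
         rt = enc_run \<Gamma>1;
         rs = (if rh < length rt then rt ! rh else Blank);
         (q', a, d1, d2, mv) = transition N q (w wh) rs;
         w' = w(wh := a);
         wh' = head_move d1 wh
     in (q', w', wh', head_move d2 rh, if mv then \<Gamma>1 @ [(PT, tape_move w' wh')] else \<Gamma>1))"

primrec mconf :: "nat \<Rightarrow> cirq \<Rightarrow> (nat \<Rightarrow> move list) \<Rightarrow> nat \<Rightarrow> mconfig" where
  "mconf N C e 0 = ((C, False, 0, []), (\<lambda>_. Blank), 0, 0, [])"
| "mconf N C e (Suc t) = mstep N (e t) (mconf N C e t)"

section \<open>Invariants of the machine\<close>

text \<open>An environment word for \<open>c\<close> has \<open>length c + 3\<close> symbols: label,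
  name, dot and bit. The fourth leaves a free place in the buffer, so a buffer equal to that word is
  not a truncation.\<close>

locale strategy = cluster_names +
  fixes C :: cirq and N :: nat
  assumes wf: "wf_cirq Cd Cc C" and win: "winnable C"
    and N: "1 \<le> N" "\<And>c. c \<in> clusters C \<Longrightarrow> length c + 4 \<le> N"
begin

definition invariant_head :: "mconfig \<Rightarrow> bool" where
  "invariant_head cfg = (case cfg of ((X, ret, k, buf), w, wh, rh, \<Gamma>) \<Rightarrow>
     wh = k \<and> X \<in> residuals C \<and> wf_cirq Cd Cc X \<and> winnable X \<and> (ret \<longrightarrow> 0 < k \<and> k \<le> N) \<and>
     (\<not> ret \<longrightarrow> (case next_choice X of None \<Rightarrow> k = 0
        | Some (d, b) \<Rightarrow> k < length (choice_move d b) \<and> tape_move w k = take k (choice_move d b))))"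

text \<open>The last conjunct ranges over all earlier head positions because the buffer itself
  remembers only the current move.\<close>

definition invariant_read :: "mconfig \<Rightarrow> bool" where
  "invariant_read cfg = (case cfg of ((X, ret, k, buf), w, wh, rh, \<Gamma>) \<Rightarrow>
     rh \<le> length (enc_run \<Gamma>) \<and> buf = buffer N (take rh (enc_run \<Gamma>)) \<and>
     (\<forall>j\<le>rh. \<forall>c b. buffer N (take j (enc_run \<Gamma>)) = env_word c b \<longrightarrow> c \<notin> conj_clusters X))"

text \<open>The whole run cannot be required to be legal, as the environment may have spoiled it;
  only the machine's own moves are constrained.\<close>

definition invariant_run :: "mconfig \<Rightarrow> bool" where
  "invariant_run cfg = (case cfg of ((X, ret, k, buf), w, wh, rh, \<Gamma>) \<Rightarrow>
     (\<forall>x\<in>set \<Gamma>. fst x = PT \<longrightarrow> (\<exists>d b. x = (PT, choice_move d b) \<and> d \<in> Cd \<and> d \<notin> clusters X)) \<and>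
     distinct (map (\<lambda>x. move_cluster (snd x)) (filter (\<lambda>x. fst x = PT) \<Gamma>)) \<and>
     residue Cd Cc (set \<Gamma>) C X)"

definition invariant :: "mconfig \<Rightarrow> bool" where
  "invariant cfg \<longleftrightarrow> invariant_head cfg \<and> invariant_read cfg \<and> invariant_run cfg"

text \<open>The second argument is the run after the moves of the environment in the current clock cycle.\<close>

inductive mtrans :: "mconfig \<Rightarrow> lmove list \<Rightarrow> mconfig \<Rightarrow> bool" where
  rewinding: "k > 0 \<Longrightarrow> mtrans ((X, True, k, buf), w, k, rh, \<Gamma>) \<Gamma>1 ((X, 1 < k, k - 1, buf), w', k - 1, rh, \<Gamma>1)"
| writing: "next_choice X = Some (d, b) \<Longrightarrow> Suc k < length (choice_move d b) \<Longrightarrow>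
    mtrans ((X, False, k, buf), w, k, rh, \<Gamma>) \<Gamma>1
      ((X, False, Suc k, buf), w(k := Ch (choice_move d b ! k)), Suc k, rh, \<Gamma>1)"
| emitting: "next_choice X = Some (d, b) \<Longrightarrow> Suc k = length (choice_move d b) \<Longrightarrow>
    mtrans ((X, False, k, buf), w, k, rh, \<Gamma>) \<Gamma>1
      ((resolve_disj d b X, True, Suc k, buf), w', Suc k, rh, \<Gamma>1 @ [(PT, choice_move d b)])"
| waiting: "next_choice X = None \<Longrightarrow> rh = length (enc_run \<Gamma>1) \<Longrightarrow>
    mtrans ((X, False, 0, buf), w, 0, rh, \<Gamma>) \<Gamma>1 ((X, False, 0, buf), w', 0, rh, \<Gamma>1)"
| scanning: "next_choice X = None \<Longrightarrow> rh < length (enc_run \<Gamma>1) \<Longrightarrow> buf' = push N buf (enc_run \<Gamma>1 ! rh) \<Longrightarrow>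
    mtrans ((X, False, 0, buf), w, 0, rh, \<Gamma>) \<Gamma>1 ((absorb buf' X, False, 0, buf'), w', 0, Suc rh, \<Gamma>1)"

lemma choice_move_neq_Nil [simp]: "choice_move c b \<noteq> []"
  by (simp add: choice_move_def)

lemma choice_length: "X \<in> residuals C \<Longrightarrow> c \<in> clusters X \<Longrightarrow> length (choice_move c b) + 2 \<le> N"
  using clusters_residuals[of X C] N(2)[of c] by (auto simp: choice_move_def)

lemma next_choice_cluster: "next_choice X = Some (d, b) \<Longrightarrow> d \<in> clusters X"
  using next_choice_Some(1) clusters_eq by blast

lemma mstep_mtrans:
  assumes "invariant cfg"
  shows "mtrans cfg (snd (snd (snd (snd cfg))) @ map (Pair PB) em) (mstep N em cfg)"
proof -
  obtain X ret k buf w wh rh \<Gamma> where cfg: "cfg = ((X, ret, k, buf), w, wh, rh, \<Gamma>)" by (metis prod.collapse)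
  let ?\<Gamma>1 = "\<Gamma> @ map (Pair PB) em"
  have wh: "wh = k" and kpos: "ret \<longrightarrow> 0 < k" and
    nc: "\<not> ret \<Longrightarrow> (case next_choice X of None \<Rightarrow> k = 0
        | Some (d, b) \<Rightarrow> k < length (choice_move d b) \<and> tape_move w k = take k (choice_move d b))"
    using assms unfolding invariant_def invariant_head_def cfg by auto
  have rh: "rh \<le> length (enc_run ?\<Gamma>1)"
    using assms unfolding invariant_def invariant_read_def cfg by (auto simp: enc_run_append)
  show ?thesis
  proof (cases ret)
    case True
    then show ?thesis unfolding cfg mstep_def wh using kpos mtrans.rewinding[of k] by simp
  next
    case False
    show ?thesis
    proof (cases "next_choice X")
      case None
      then have k: "k = 0" using nc False by simp
      have nb: "rh < length (enc_run ?\<Gamma>1) \<Longrightarrow> enc_run ?\<Gamma>1 ! rh \<noteq> Blank"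
        using Blank_notin_enc_run nth_mem by metis
      show ?thesis
      proof (cases "rh < length (enc_run ?\<Gamma>1)")
        case True
        then show ?thesis unfolding cfg mstep_def wh k
          using False None nb by (auto simp: Let_def intro: mtrans.scanning)
      next
        case 2: False
        then show ?thesis unfolding cfg mstep_def wh k
          using False None rh by (auto simp: Let_def intro!: mtrans.waiting)
      qed
    next
      case (Some x)
      obtain d b where x: "x = (d, b)" by (cases x)
      then have kl: "k < length (choice_move d b)" and tm: "tape_move w k = take k (choice_move d b)"
        using nc False Some by auto
      show ?thesis
      proof (cases "Suc k = length (choice_move d b)")
        case True
        have "tape_move (w(k := Ch (choice_move d b ! k))) (Suc k) = choice_move d b"
          unfolding tape_move_write tm using kl True by (metis take_Suc_conv_app_nth take_all_iff order.refl)
        then show ?thesis unfolding cfg mstep_def wh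
          using False Some x True
            mtrans.emitting[of X d b k buf w rh \<Gamma> ?\<Gamma>1 "w(k := Ch (choice_move d b ! k))"] by simp
      next
        case 2: False
        then show ?thesis unfolding cfg mstep_def wh
          using False Some x kl by (auto intro!: mtrans.writing)
      qed
    qed
  qed
qed


text \<open>The first dot fixes the cluster, so no choice move properly extends another. This
  justifies absorbing a word before it is known whether the move ends there.\<close>

lemma choice_move_prefix:
  assumes "c \<in> Cd \<union> Cc" "c' \<in> Cd \<union> Cc" "choice_move c b @ m = choice_move c' b'"
  shows "m = []"
proof -
  have "takeWhile (\<lambda>x. x \<noteq> CHR ''.'') (choice_move c b @ m) = c"
    using no_dot[OF assms(1)] unfolding choice_move_def append_assoc by (subst takeWhile_append2) auto
  then have "c = c'"
    using move_cluster_choice[OF assms(2), of b'] assms(3) unfolding move_cluster_def by simp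
  then show ?thesis using assms(3) by (simp add: choice_move_def)
qed

lemma clusters_resolve_disj_subset: "clusters (resolve_disj c b X) \<subseteq> clusters X"
  using disj_clusters_resolve_disj[of c b X] conj_clusters_resolve_disj[of c b X] unfolding clusters_eq by blast

lemma clusters_resolve_conj_subset: "clusters (resolve_conj c b X) \<subseteq> clusters X"
  using disj_clusters_resolve_conj[of c b X] conj_clusters_resolve_conj[of c b X] unfolding clusters_eq by blast

lemma not_in_clusters_resolve_disj:
  assumes "wf_cirq Cd Cc X" "c \<in> Cd" shows "c \<notin> clusters (resolve_disj c b X)"
  using wf_resolve_disj[OF assms(1), of c b] disj_clusters_resolve_disj[of c b X] assms(2) disjoint
  unfolding clusters_eq wf_cirq_iff by blast

lemma not_in_clusters_resolve_conj:
  assumes "wf_cirq Cd Cc X" "c \<in> Cc" shows "c \<notin> clusters (resolve_conj c b X)"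
  using wf_resolve_conj[OF assms(1), of c b] conj_clusters_resolve_conj[of c b X] assms(2) disjoint
  unfolding clusters_eq wf_cirq_iff by blast

lemma absorb_preserves:
  assumes "X \<in> residuals C" "wf_cirq Cd Cc X" "winnable X"
  shows "absorb buf X \<in> residuals C" "wf_cirq Cd Cc (absorb buf X)" "winnable (absorb buf X)"
    "conj_clusters (absorb buf X) \<subseteq> conj_clusters X" "clusters (absorb buf X) \<subseteq> clusters X"
proof -
  have "absorb buf X \<in> residuals C \<and> wf_cirq Cd Cc (absorb buf X) \<and> winnable (absorb buf X) \<and>
    conj_clusters (absorb buf X) \<subseteq> conj_clusters X \<and> clusters (absorb buf X) \<subseteq> clusters X"
  proof (cases rule: absorb_cases[of buf X])
    case (2 c b)
    show ?thesis
      unfolding 2(3) using assms conj_clusters_resolve_conj clusters_resolve_conj_subset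
      by (blast intro: resolve_conj_residuals wf_resolve_conj winnable_resolve_conj)
  qed (use assms in simp)
  then show "absorb buf X \<in> residuals C" "wf_cirq Cd Cc (absorb buf X)" "winnable (absorb buf X)"
    "conj_clusters (absorb buf X) \<subseteq> conj_clusters X" "clusters (absorb buf X) \<subseteq> clusters X"
    by blast+
qed

lemma invariant_head_step:
  assumes "invariant_head cfg" "mtrans cfg \<Gamma>1 cfg'" shows "invariant_head cfg'"
  using assms(2,1)
proof cases
  case (rewinding k X buf w rh \<Gamma> w')
  then show ?thesis using assms(1)
    by (auto simp: invariant_head_def choice_move_def split: option.split)
next
  case (writing X d b k buf w rh \<Gamma>)
  then show ?thesis using assms(1)
    by (auto simp: invariant_head_def tape_move_write take_Suc_conv_app_nth simp del: fun_upd_apply)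
next
  case (emitting X d b k buf w rh \<Gamma> w')
  have X: "X \<in> residuals C" "wf_cirq Cd Cc X" using assms(1) emitting by (auto simp: invariant_head_def)
  have "Suc k \<le> N"
    using choice_length[OF X(1) next_choice_cluster[OF emitting(3)], of b] emitting(4) by simp
  then show ?thesis using emitting X next_choice_Some(2)[OF emitting(3)]
    by (simp add: invariant_head_def resolve_disj_residuals wf_resolve_disj)
next
  case (waiting X rh buf w \<Gamma> w')
  then show ?thesis using assms(1) by (auto simp: invariant_head_def)
next
  case (scanning X rh buf' buf w \<Gamma> w')
  then show ?thesis using assms(1) absorb_preserves[of X buf']
    by (auto simp: invariant_head_def choice_move_def split: option.split)
qed

lemma invariant_read_extend:
  assumes "invariant_read ((X, ret, k, buf), w, wh, rh, \<Gamma>)" "conj_clusters X' \<subseteq> conj_clusters X"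
  shows "invariant_read ((X', ret', k', buf), w', wh', rh, \<Gamma> @ \<Delta>)"
  using assms unfolding invariant_read_def by (auto simp: enc_run_append)

lemma invariant_read_step:
  assumes "invariant_head cfg" "invariant_read cfg" "mtrans cfg (snd (snd (snd (snd cfg))) @ \<Delta>) cfg'" shows "invariant_read cfg'"
  using assms(3)
proof cases
  case (rewinding k X buf w rh \<Gamma> w')
  then show ?thesis using assms(2) by (auto intro: invariant_read_extend)
next
  case (writing X d b k buf w rh \<Gamma>)
  then show ?thesis using assms(2) by (auto intro: invariant_read_extend)
next
  case (emitting X d b k buf w rh \<Gamma> w')
  then show ?thesis using assms(2)
    by (auto intro!: invariant_read_extend[OF _ conj_clusters_resolve_disj])
next
  case (waiting X rh buf w \<Gamma> w')
  have cfg: "cfg = ((X, False, 0, buf), w, 0, rh, \<Gamma>)" using waiting by auto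
  have "cfg' = ((X, False, 0, buf), w', 0, rh, \<Gamma> @ \<Delta>)"
    using waiting(2) unfolding cfg by simp
  then show ?thesis using assms(2) unfolding cfg by (blast intro: invariant_read_extend)
next
  case (scanning X rh buf' buf w \<Gamma> w')
  let ?\<Gamma>1 = "\<Gamma> @ \<Delta>"
  have cfg: "cfg = ((X, False, 0, buf), w, 0, rh, \<Gamma>)" using scanning by auto
  have "invariant_read ((X, False, 0, buf), w, 0, rh, ?\<Gamma>1)"
    using assms(2) unfolding cfg by (rule invariant_read_extend) simp
  then have r: "rh \<le> length (enc_run ?\<Gamma>1)" "buf = buffer N (take rh (enc_run ?\<Gamma>1))"
    "\<And>j c b. j \<le> rh \<Longrightarrow> buffer N (take j (enc_run ?\<Gamma>1)) = env_word c b \<Longrightarrow> c \<notin> conj_clusters X"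
    unfolding invariant_read_def by auto
  have rh: "rh < length (enc_run ?\<Gamma>1)" and buf': "buf' = push N buf (enc_run ?\<Gamma>1 ! rh)"
    using scanning by auto
  have b: "buffer N (take (Suc rh) (enc_run ?\<Gamma>1)) = buf'"
    using rh unfolding buf' r(2) by (simp add: take_Suc_conv_app_nth buffer_snoc)
  have X: "X \<in> residuals C" "wf_cirq Cd Cc X" "winnable X"
    using assms(1) unfolding cfg invariant_head_def by auto
  have new: "c \<notin> conj_clusters (absorb buf' X)" if "buf' = env_word c b" for c b
  proof (cases "c \<in> conj_clusters X")
    case True
    then show ?thesis
      using absorb_env_word[of c X b] conj_clusters_resolve_conj[of c b X] unfolding that by auto
  next
    case False
    then show ?thesis using absorb_preserves(4)[OF X] by blast
  qed
  have "c \<notin> conj_clusters (absorb buf' X)"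
    if "j \<le> Suc rh" "buffer N (take j (enc_run ?\<Gamma>1)) = env_word c b" for j c b
  proof (cases "j = Suc rh")
    case True
    then show ?thesis using new that(2) b by metis
  next
    case False
    then have "j \<le> rh" using that(1) by simp
    then have "c \<notin> conj_clusters X" using r(3) that(2) by blast
    then show ?thesis using absorb_preserves(4)[OF X] by blast
  qed
  moreover have "cfg' = ((absorb buf' X, False, 0, buf'), w', 0, Suc rh, ?\<Gamma>1)" using scanning by auto
  ultimately show ?thesis using rh b unfolding invariant_read_def by (auto simp del: list.inject)
qed

lemma invariant_run_env:
  assumes "invariant_run ((X, ret, k, buf), w, wh, rh, \<Gamma>)"
  shows "invariant_run ((X, ret', k', buf'), w', wh', rh', \<Gamma> @ map (Pair PB) em)"
proof -
  have "filter (\<lambda>x. fst x = PT) (map (Pair PB) em) = []" by (induction em) auto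
  then show ?thesis
    using assms unfolding invariant_run_def by (auto intro: residue_mono)
qed

text \<open>If the word just read is only the beginning of a longer move, that move is illegal, no
  consistent set contains the run, and the claim is void.\<close>

lemma residue_absorb:
  assumes "residue Cd Cc (set \<Gamma>) C X" "X \<in> residuals C" "wf_cirq Cd Cc X"
    "buf = buffer N (take j (enc_run \<Gamma>))"
  shows "residue Cd Cc (set \<Gamma>) C (absorb buf X)"
proof (cases rule: absorb_cases[of buf X])
  case (2 c b)
  then have "c \<in> clusters X" by (simp add: clusters_eq)
  then have "length (choice_move c b) < N - 1" using choice_length[OF assms(2), of c b] by linarith
  then obtain m where m: "(PB, choice_move c b @ m) \<in> set \<Gamma>"
    using buffer_prefix[OF N(1)] 2(2) assms(4) by metis
  have "holds I (choices S) (choices S) C = holds I (choices S) (choices S) (resolve_conj c b X)"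
    if S: "consistent Cd Cc S" "set \<Gamma> \<subseteq> S" for S I
  proof -
    have "legal_move Cd Cc (PB, choice_move c b @ m)" using S m unfolding consistent_def by blast
    then obtain c' b' where c': "choice_move c b @ m = choice_move c' b'" "c' \<in> Cc"
      by (auto simp: legal_move_iff)
    moreover have "c \<in> Cc" using 2(1) assms(3) unfolding wf_cirq_iff by blast
    ultimately have "m = []" using choice_move_prefix by blast
    then have "(PB, choice_move c b) \<in> set \<Gamma>" using m by simp
    then show ?thesis using residue_resolve(2)[OF assms(1)] S unfolding residue_def by blast
  qed
  then show ?thesis unfolding 2(3) residue_def by blast
qed (use assms in simp)

lemma invariant_run_step:
  assumes "invariant cfg" "mtrans cfg (snd (snd (snd (snd cfg))) @ map (Pair PB) em) cfg'" shows "invariant_run cfg'"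
  using assms(2)
proof cases
  case (rewinding k X buf w rh \<Gamma> w')
  then show ?thesis using assms(1) by (auto simp: invariant_def intro: invariant_run_env)
next
  case (writing X d b k buf w rh \<Gamma>)
  then show ?thesis using assms(1) by (auto simp: invariant_def intro: invariant_run_env)
next
  case (waiting X rh buf w \<Gamma> w')
  have cfg: "cfg = ((X, False, 0, buf), w, 0, rh, \<Gamma>)" using waiting by auto
  have "cfg' = ((X, False, 0, buf), w', 0, rh, \<Gamma> @ map (Pair PB) em)"
    using waiting(2) unfolding cfg by simp
  then show ?thesis using assms(1) unfolding cfg invariant_def by (blast intro: invariant_run_env)
next
  case (emitting X d b k buf w rh \<Gamma> w')
  let ?\<Gamma>1 = "\<Gamma> @ map (Pair PB) em" and ?x = "(PT, choice_move d b)"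
  have cfg: "cfg = ((X, False, k, buf), w, k, rh, \<Gamma>)" using emitting by auto
  have "invariant_run ((X, False, k, buf), w, k, rh, ?\<Gamma>1)"
    using assms(1) unfolding cfg invariant_def by (blast intro: invariant_run_env)
  then have r: "\<And>x. x \<in> set ?\<Gamma>1 \<Longrightarrow> fst x = PT \<Longrightarrow> \<exists>d b. x = (PT, choice_move d b) \<and> d \<in> Cd \<and> d \<notin> clusters X"
    "distinct (map (\<lambda>x. move_cluster (snd x)) (filter (\<lambda>x. fst x = PT) ?\<Gamma>1))"
    "residue Cd Cc (set ?\<Gamma>1) C X" unfolding invariant_run_def by auto
  have wfX: "wf_cirq Cd Cc X" using assms(1) unfolding cfg invariant_def invariant_head_def by auto
  have d: "d \<in> clusters X" "d \<in> Cd"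
    using next_choice_Some(1)[OF emitting(3)] wfX by (auto simp: clusters_eq wf_cirq_iff)
  have "\<exists>d' b'. x = (PT, choice_move d' b') \<and> d' \<in> Cd \<and> d' \<notin> clusters (resolve_disj d b X)"
    if "x \<in> set (?\<Gamma>1 @ [?x])" "fst x = PT" for x
  proof (cases "x = ?x")
    case True
    then show ?thesis using d not_in_clusters_resolve_disj[OF wfX d(2)] by blast
  next
    case False
    then show ?thesis using r(1)[of x] that clusters_resolve_disj_subset[of d b X] by auto
  qed
  \<comment> \<open>Earlier machine moves concern clusters absent from \<open>X\<close>, whereas
    \<open>d\<close> still occurs in it.\<close>
  moreover have "move_cluster (snd x) \<noteq> d" if "x \<in> set ?\<Gamma>1" "fst x = PT" for x
    using r(1)[OF that] d(1) by auto
  then have "d \<notin> (\<lambda>x. move_cluster (snd x)) ` set (filter (\<lambda>x. fst x = PT) ?\<Gamma>1)" by auto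
  then have "distinct (map (\<lambda>x. move_cluster (snd x)) (filter (\<lambda>x. fst x = PT) (?\<Gamma>1 @ [?x])))"
    using r(2) d(2) unfolding filter_append[of _ ?\<Gamma>1] map_append[of _ "filter _ ?\<Gamma>1"] distinct_append
    by simp
  moreover have "residue Cd Cc (set (?\<Gamma>1 @ [?x])) C X"
    using r(3) by (rule residue_mono) auto
  then have "residue Cd Cc (set (?\<Gamma>1 @ [?x])) C (resolve_disj d b X)"
    by (rule residue_resolve(1)[where p = PT]) simp
  moreover have "cfg' = ((resolve_disj d b X, True, Suc k, buf), w', Suc k, rh, ?\<Gamma>1 @ [?x])"
    using emitting by auto
  ultimately show ?thesis unfolding invariant_run_def by (simp only: prod.case) blast
next
  case (scanning X rh buf' buf w \<Gamma> w')
  let ?\<Gamma>1 = "\<Gamma> @ map (Pair PB) em"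
  have cfg: "cfg = ((X, False, 0, buf), w, 0, rh, \<Gamma>)" using scanning by auto
  have "invariant_run ((X, False, 0, buf), w, 0, rh, ?\<Gamma>1)"
    using assms(1) unfolding cfg invariant_def by (blast intro: invariant_run_env)
  then have r: "\<And>x. x \<in> set ?\<Gamma>1 \<Longrightarrow> fst x = PT \<Longrightarrow> \<exists>d b. x = (PT, choice_move d b) \<and> d \<in> Cd \<and> d \<notin> clusters X"
    "distinct (map (\<lambda>x. move_cluster (snd x)) (filter (\<lambda>x. fst x = PT) ?\<Gamma>1))"
    "residue Cd Cc (set ?\<Gamma>1) C X" unfolding invariant_run_def by auto
  have X: "X \<in> residuals C" "wf_cirq Cd Cc X" "winnable X"
    using assms(1) unfolding cfg invariant_def invariant_head_def by auto
  have "invariant_read ((X, False, 0, buf), w, 0, rh, ?\<Gamma>1)"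
    using assms(1) unfolding cfg invariant_def by (blast intro: invariant_read_extend)
  then have "buf = buffer N (take rh (enc_run ?\<Gamma>1))" unfolding invariant_read_def by auto
  moreover have rh: "rh < length (enc_run ?\<Gamma>1)" and buf': "buf' = push N buf (enc_run ?\<Gamma>1 ! rh)"
    using scanning by auto
  ultimately have "buf' = buffer N (take (Suc rh) (enc_run ?\<Gamma>1))"
    by (simp add: take_Suc_conv_app_nth buffer_snoc)
  then have "residue Cd Cc (set ?\<Gamma>1) C (absorb buf' X)"
    using residue_absorb[OF r(3) X(1,2)] by blast
  moreover have "\<exists>d b. x = (PT, choice_move d b) \<and> d \<in> Cd \<and> d \<notin> clusters (absorb buf' X)"
    if "x \<in> set ?\<Gamma>1" "fst x = PT" for x
    using r(1)[OF that] absorb_preserves(5)[OF X] by blast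
  moreover have "cfg' = ((absorb buf' X, False, 0, buf'), w', 0, Suc rh, ?\<Gamma>1)" using scanning by auto
  ultimately show ?thesis using r(2) unfolding invariant_run_def by (simp only: prod.case) blast
qed

lemma invariant_step:
  assumes "invariant cfg" shows "invariant (mstep N em cfg)"
  using assms mstep_mtrans[OF assms, of em] invariant_head_step invariant_read_step invariant_run_step unfolding invariant_def by metis

lemma invariant_mconf: "invariant (mconf N C e t)"
proof (induction t)
  case 0
  show ?case using wf win
    by (auto simp: invariant_def invariant_head_def invariant_read_def invariant_run_def choice_move_def split: option.split)
next
  case (Suc t)
  then show ?case by (simp add: invariant_step)
qed


section \<open>Progress and victory\<close>

abbreviation residual :: "mconfig \<Rightarrow> cirq" where
  "residual cfg \<equiv> fst (fst cfg)"

abbreviation run_head :: "mconfig \<Rightarrow> nat" where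
  "run_head cfg \<equiv> fst (snd (snd (snd cfg)))"

abbreviation run_of :: "mconfig \<Rightarrow> lmove list" where
  "run_of cfg \<equiv> snd (snd (snd (snd cfg)))"

text \<open>The machine rewinds before it writes again, so the offset \<open>Suc N\<close> places
  every returning state above every other one.\<close>

definition mode_measure :: "mconfig \<Rightarrow> nat" where
  "mode_measure cfg = (case cfg of ((X, ret, k, buf), _) \<Rightarrow> if ret then Suc N + k else N - k)"

lemma resolve_conj_psubset:
  assumes "wf_cirq Cd Cc X" "c \<in> conj_clusters X" shows "clusters (resolve_conj c b X) \<subset> clusters X"
proof -
  have "c \<in> Cc" "c \<in> clusters X" using assms unfolding wf_cirq_iff clusters_eq by blast+
  then show ?thesis
    using not_in_clusters_resolve_conj[OF assms(1)] clusters_resolve_conj_subset[of c b X] by blast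
qed

lemma resolve_disj_psubset:
  assumes "wf_cirq Cd Cc X" "d \<in> disj_clusters X" shows "clusters (resolve_disj d b X) \<subset> clusters X"
proof -
  have "d \<in> Cd" "d \<in> clusters X" using assms unfolding wf_cirq_iff clusters_eq by blast+
  then show ?thesis
    using not_in_clusters_resolve_disj[OF assms(1)] clusters_resolve_disj_subset[of d b X] by blast
qed

text \<open>Only waiting and scanning can go on for ever; rewinding and writing are bounded, and
  emitting or absorbing a choice removes a cluster.\<close>

lemma mtrans_progress:
  assumes "invariant cfg" "mtrans cfg \<Gamma>1 cfg'"
  shows "card (clusters (residual cfg')) < card (clusters (residual cfg)) \<or>
    residual cfg' = residual cfg \<and> (mode_measure cfg' < mode_measure cfg \<or>
      next_choice (residual cfg) = None \<and> mode_measure cfg' = mode_measure cfg \<and>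
        (run_head cfg < length (enc_run \<Gamma>1) \<longrightarrow> run_head cfg' = Suc (run_head cfg)))"
  using assms(2)
proof cases
  case (rewinding k X buf w rh \<Gamma> w')
  then show ?thesis by (auto simp: mode_measure_def)
next
  case (writing X d b k buf w rh \<Gamma>)
  then have "X \<in> residuals C" using assms(1) unfolding invariant_def invariant_head_def by auto
  then have "Suc k < N"
    using choice_length[of X d b] next_choice_cluster[OF writing(3)] writing(4) by linarith
  then show ?thesis using writing by (auto simp: mode_measure_def)
next
  case (emitting X d b k buf w rh \<Gamma> w')
  then have "wf_cirq Cd Cc X" using assms(1) unfolding invariant_def invariant_head_def by auto
  then have "clusters (resolve_disj d b X) \<subset> clusters X"
    using next_choice_Some(1)[OF emitting(3)] by (rule resolve_disj_psubset)
  then show ?thesis using emitting by (simp add: psubset_card_mono)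
next
  case (waiting X rh buf w \<Gamma> w')
  then show ?thesis by (auto simp: mode_measure_def)
next
  case (scanning X rh buf' buf w \<Gamma> w')
  then have wfX: "wf_cirq Cd Cc X" using assms(1) unfolding invariant_def invariant_head_def by auto
  show ?thesis
  proof (cases rule: absorb_cases[of buf' X])
    case 1
    then show ?thesis using scanning by (simp add: mode_measure_def)
  next
    case (2 c b)
    have "clusters (absorb buf' X) \<subset> clusters X" unfolding 2(3) using wfX 2(1) by (rule resolve_conj_psubset)
    then show ?thesis using scanning by (simp add: psubset_card_mono)
  qed
qed

context
  fixes e :: "nat \<Rightarrow> move list"
begin

abbreviation conf :: "nat \<Rightarrow> mconfig" where
  "conf t \<equiv> mconf N C e t"

lemma mtrans_conf: "mtrans (conf t) (run_of (conf t) @ map (Pair PB) (e t)) (conf (Suc t))"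
  using mstep_mtrans[OF invariant_mconf, of e t "e t"] by simp

lemma run_of_Suc: "\<exists>\<Delta>. run_of (conf (Suc t)) = run_of (conf t) @ \<Delta>"
  using mtrans_conf[of t] by cases auto

lemma run_of_le: "t \<le> s \<Longrightarrow> \<exists>\<Delta>. run_of (conf s) = run_of (conf t) @ \<Delta>"
proof (induction s)
  case (Suc s)
  then show ?case using run_of_Suc[of s] by (cases "t = Suc s") auto
qed simp

text \<open>The run tape may grow faster than it is read, so the target is a fixed cell
  \<open>p\<close>: once choices and head movements subside, each cycle brings the run head one cell
  closer to it.\<close>

lemma reads_every_symbol: "p < length (enc_run (run_of (conf t))) \<Longrightarrow> \<exists>s\<ge>t. p < run_head (conf s)"
proof (induction t rule: wf_induct_rule[OF wf_measures[of "[\<lambda>t. card (clusters (residual (conf t))),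
      \<lambda>t. mode_measure (conf t), \<lambda>t. Suc p - run_head (conf t)]"]])
  case (1 t)
  show ?case
  proof (cases "p < run_head (conf t)")
    case False
    let ?\<Gamma>1 = "run_of (conf t) @ map (Pair PB) (e t)"
    have "run_head (conf t) < length (enc_run ?\<Gamma>1)" using False "1.prems" by (simp add: enc_run_append)
    then have "(Suc t, t) \<in> measures [\<lambda>t. card (clusters (residual (conf t))),
      \<lambda>t. mode_measure (conf t), \<lambda>t. Suc p - run_head (conf t)]"
      using mtrans_progress[OF invariant_mconf mtrans_conf, of t] False by auto
    moreover have "p < length (enc_run (run_of (conf (Suc t))))"
      using run_of_Suc[of t] "1.prems" by (auto simp: enc_run_append simp del: mconf.simps)
    ultimately obtain s where "s \<ge> Suc t" "p < run_head (conf s)" using "1.IH" by blast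
    then show ?thesis using Suc_leD by blast
  qed blast
qed

lemma residual_stabilises:
  obtains T where "\<And>t. t \<ge> T \<Longrightarrow> residual (conf t) = residual (conf T)" "next_choice (residual (conf T)) = None"
proof -
  let ?c = "\<lambda>t. card (clusters (residual (conf t)))"
  \<comment> \<open>From a time with the fewest open clusters on, no cluster can disappear, and so
    the residual is frozen.\<close>
  obtain T where T: "\<And>t. ?c T \<le> ?c t" using ex_has_least_nat[of "\<lambda>_. True" 0 ?c] by auto
  have stable: "residual (conf (T + n)) = residual (conf T)" for n
  proof (induction n)
    case (Suc n)
    then show ?case
      using mtrans_progress[OF invariant_mconf mtrans_conf, of "T + n"] T[of "Suc (T + n)"]
      by (auto simp del: mconf.simps)
  qed simp
  have "next_choice (residual (conf T)) = None"
  proof (rule ccontr)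
    assume some: "next_choice (residual (conf T)) \<noteq> None"
    have "mode_measure (conf (T + n)) + n \<le> mode_measure (conf T)" for n
    proof (induction n)
      case (Suc n)
      have "mode_measure (conf (Suc (T + n))) < mode_measure (conf (T + n))"
        using mtrans_progress[OF invariant_mconf mtrans_conf, of "T + n"] some stable[of n] stable[of "Suc n"]
        by (auto simp del: mconf.simps)
      then show ?case using Suc by (simp del: mconf.simps)
    qed simp
    from this[of "Suc (mode_measure (conf T))"] show False by simp
  qed
  moreover have "residual (conf t) = residual (conf T)" if "t \<ge> T" for t
    using stable[of "t - T"] that by simp
  ultimately show ?thesis using that by blast
qed

lemma machine_moves:
  assumes "x \<in> set (run_of (conf t))" "fst x = PT"
  shows "\<exists>d b. x = (PT, choice_move d b) \<and> d \<in> Cd \<and> d \<notin> clusters (residual (conf t))"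
proof -
  obtain X ret k buf w wh rh \<Gamma> where cfg: "conf t = ((X, ret, k, buf), w, wh, rh, \<Gamma>)" by (metis prod.collapse)
  show ?thesis using invariant_mconf[of e t] assms unfolding cfg invariant_def invariant_run_def by auto
qed

lemma machine_moves_distinct:
  "distinct (map (\<lambda>x. move_cluster (snd x)) (filter (\<lambda>x. fst x = PT) (run_of (conf t))))"
proof -
  obtain X ret k buf w wh rh \<Gamma> where cfg: "conf t = ((X, ret, k, buf), w, wh, rh, \<Gamma>)" by (metis prod.collapse)
  show ?thesis using invariant_mconf[of e t] unfolding cfg invariant_def invariant_run_def by auto
qed

lemma residue_conf: "residue Cd Cc (set (run_of (conf t))) C (residual (conf t))"
proof -
  obtain X ret k buf w wh rh \<Gamma> where cfg: "conf t = ((X, ret, k, buf), w, wh, rh, \<Gamma>)" by (metis prod.collapse)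
  show ?thesis using invariant_mconf[of e t] unfolding cfg invariant_def invariant_run_def by auto
qed

lemma conf_props: "residual (conf t) \<in> residuals C" "wf_cirq Cd Cc (residual (conf t))" "winnable (residual (conf t))"
proof -
  obtain X ret k buf w wh rh \<Gamma> where cfg: "conf t = ((X, ret, k, buf), w, wh, rh, \<Gamma>)" by (metis prod.collapse)
  show "residual (conf t) \<in> residuals C" "wf_cirq Cd Cc (residual (conf t))" "winnable (residual (conf t))"
    using invariant_mconf[of e t] unfolding cfg invariant_def invariant_head_def by auto
qed

lemma read_choice_resolved:
  assumes "buffer N (take j (enc_run (run_of (conf t)))) = env_word c b" "j \<le> run_head (conf t)"
  shows "c \<notin> conj_clusters (residual (conf t))"
proof -
  obtain X ret k buf w wh rh \<Gamma> where cfg: "conf t = ((X, ret, k, buf), w, wh, rh, \<Gamma>)" by (metis prod.collapse)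
  show ?thesis using invariant_mconf[of e t] assms unfolding cfg invariant_def invariant_read_def
    by (auto simp del: list.inject)
qed

text \<open>Machine moves use pairwise distinct disjunctive clusters and legal environment moves use
  conjunctive ones, so a machine move is never the first illegal one.\<close>

lemma illegal_run_environment:
  assumes "\<not> legal_run Cd Cc (run_of (conf t))"
  shows "fst (illegal_last Cd Cc (run_of (conf t))) = PB"
proof -
  obtain \<Gamma> x \<Delta> where split: "run_of (conf t) = \<Gamma> @ x # \<Delta>" "legal_run Cd Cc \<Gamma>" "\<not> legal_run Cd Cc (\<Gamma> @ [x])"
    using illegal_run_split[OF assms] by blast
  have False if PT: "fst x = PT"
  proof -
    obtain d b where d: "x = (PT, choice_move d b)" "d \<in> Cd"
      using machine_moves[of x t] split(1) PT by auto
    then have "legal_move Cd Cc x" by (auto simp: legal_move_iff)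
    then obtain y where y: "y \<in> set \<Gamma>" "move_cluster (snd y) = d"
      using split(2,3) d unfolding legal_run_iff by auto
    show False
    proof (cases "fst y = PT")
      case True
      then have "y \<in> set (filter (\<lambda>x. fst x = PT) \<Gamma>)" using y by simp
      moreover have "distinct (map (\<lambda>x. move_cluster (snd x)) (filter (\<lambda>x. fst x = PT) (\<Gamma> @ x # \<Delta>)))"
        using machine_moves_distinct[of t] split(1) by simp
      ultimately show False using PT y(2) d by force
    next
      case False
      have "legal_move Cd Cc y" using y(1) split(2) unfolding legal_run_iff by blast
      then obtain c b' where "y = (PB, choice_move c b')" "c \<in> Cc"
        using False by (auto simp: legal_move_iff)
      then show False using y(2) d(2) disjoint by auto
    qed
  qed
  then have "fst x = PB" using player.exhaust by blast
  then show ?thesis using illegal_last_eq[OF split(2,3)] split(1) by simp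
qed

text \<open>In a legal run the settled residual has none of its clusters resolved, since the machine
  would have avoided or absorbed such a move. As no choice is pending, it is true with everything
  open.\<close>

lemma machine_wins: "top_wins Cd Cc I C (\<lambda>t. run_of (conf t))"
proof (cases "\<forall>t. legal_run Cd Cc (run_of (conf t))")
  case False
  then show ?thesis using illegal_run_environment unfolding top_wins_def by auto
next
  case True
  obtain T where T: "\<And>t. t \<ge> T \<Longrightarrow> residual (conf t) = residual (conf T)" "next_choice (residual (conf T)) = None"
    by (rule residual_stabilises) blast
  define X where "X = residual (conf T)"
  let ?S = "\<Union>t. set (run_of (conf t))"
  have "set (run_of (conf t)) \<subseteq> set (run_of (conf (Suc t)))" for t
    using run_of_Suc[of t] by (auto simp del: mconf.simps)
  then have cons: "consistent Cd Cc ?S"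
    using True by (intro consistent_Union legal_run_consistent) auto
  have late: "\<exists>t\<ge>T. x \<in> set (run_of (conf t))" if x: "x \<in> ?S" for x
  proof -
    obtain t where "x \<in> set (run_of (conf t))" using x by blast
    then have "x \<in> set (run_of (conf (max t T)))" using run_of_le[of t "max t T"] by auto
    then show ?thesis by (intro exI[of _ "max t T"]) simp
  qed
  have "choices ?S c = None" if "c \<in> clusters X" for c
  proof -
    have "(p, choice_move c b) \<notin> ?S" for p b
    proof
      assume S: "(p, choice_move c b) \<in> ?S"
      then obtain t where t: "t \<ge> T" "(p, choice_move c b) \<in> set (run_of (conf t))" using late by blast
      have res: "residual (conf t) = X" using T(1)[OF t(1)] by (simp add: X_def)
      show False
      proof (cases "p = PT")
        case True
        then show False using machine_moves[OF t(2)] that res by auto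
      next
        case False
        have "legal_move Cd Cc (p, choice_move c b)" using cons S unfolding consistent_def by blast
        then have c: "p = PB" "c \<in> Cc" using False by (auto simp: legal_move_iff)
        have cX: "c \<in> conj_clusters X"
          using that c(2) disjoint conf_props(2)[of T] unfolding X_def clusters_eq wf_cirq_iff by blast
        obtain \<Gamma> \<Delta> where run: "run_of (conf t) = \<Gamma> @ (PB, choice_move c b) # \<Delta>"
          using t(2) c(1) by (meson split_list)
        \<comment> \<open>The position just after the move: once symbol \<open>j - 1\<close> has
          been read, the run head is at \<open>j\<close> or beyond and the complete word has been in
          the buffer.\<close>
        define j where "j = length (enc_run \<Gamma> @ env_word c b)"
        have enc: "enc_run (run_of (conf t)) = (enc_run \<Gamma> @ env_word c b) @ enc_run \<Delta>"
          unfolding run by (simp add: enc_run_append enc_run_Cons)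
        then have "j - 1 < length (enc_run (run_of (conf t)))" unfolding j_def by simp
        then obtain s where s: "s \<ge> t" "j - 1 < run_head (conf s)" using reads_every_symbol by blast
        have "length (choice_move c b) + 2 \<le> N"
          using choice_length[OF conf_props(1)[of T], of c b] that by (simp add: X_def)
        then have "buffer N (enc_run \<Gamma> @ env_word c b) = env_word c b"
          using buffer_move[OF N(1), of "enc_run \<Gamma>" 1 "choice_move c b"] by simp
        moreover have "take j (enc_run (run_of (conf s))) = enc_run \<Gamma> @ env_word c b"
          using run_of_le[OF s(1)] enc by (auto simp: enc_run_append j_def)
        ultimately have "c \<notin> conj_clusters (residual (conf s))"
          using s(2) by (intro read_choice_resolved[of j s c b]) auto
        then show False using T(1)[of s] s(1) t(1) cX by (simp add: X_def)
      qed
    qed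
    then show ?thesis unfolding choices_def chosen_iff by auto
  qed
  then have "holds I (choices ?S) (choices ?S) X = holds I Map.empty Map.empty X"
    by (intro holds_cong) (auto simp: clusters_eq)
  moreover have "holds I Map.empty Map.empty X"
    using next_choice_None[OF T(2) conf_props(3)] by (simp add: X_def)
  moreover have "holds I (choices ?S) (choices ?S) C = holds I (choices ?S) (choices ?S) X"
    using residue_conf[of T] cons unfolding X_def residue_def by blast
  ultimately have "win_leg I ?S C" using win_leg_holds[OF cons] by simp
  then show ?thesis using True unfolding top_wins_def by simp
qed

end

section \<open>Realization as an HPM\<close>

definition states :: "mstate set" where
  "states = residuals C \<times> (UNIV :: bool set) \<times> {..N} \<times>
     {xs. set xs \<subseteq> insert (Aux 0) (insert (Aux 1) (range Ch)) \<and> length xs \<le> N}"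

lemma finite_states: "finite states"
  unfolding states_def by (intro finite_cartesian_product finite_lists_length_le) auto

lemma conf_in_states: "fst (mconf N C e t) \<in> states"
proof -
  obtain X ret k buf w wh rh \<Gamma> where cfg: "mconf N C e t = ((X, ret, k, buf), w, wh, rh, \<Gamma>)" by (metis prod.collapse)
  have h: "invariant_head (mconf N C e t)" "invariant_read (mconf N C e t)" using invariant_mconf unfolding invariant_def by blast+
  have "k \<le> N"
  proof (cases "ret \<or> next_choice X = None")
    case True
    then show ?thesis using h(1) unfolding cfg invariant_head_def by auto
  next
    case False
    then obtain d b where db: "next_choice X = Some (d, b)" by auto
    then have "X \<in> residuals C" "k < length (choice_move d b)"
      using h(1) False unfolding cfg invariant_head_def by auto
    then show ?thesis using choice_length[OF _ next_choice_cluster[OF db], of b] by simp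
  qed
  moreover have "X \<in> residuals C" "buf = buffer N (take rh (enc_run \<Gamma>))"
    using h unfolding cfg invariant_head_def invariant_read_def by auto
  ultimately show ?thesis unfolding cfg states_def using buffer_bounded[OF N(1)] by auto
qed

lemma valid_C: "valid Cd Cc C"
proof -
  let ?W = "insert Blank (range Ch)"
  have "finite ?W" by simp
  moreover have "fst (snd (transition N q a s)) \<in> ?W" for q a s
    by (cases q) (auto split: option.split)
  ultimately obtain \<delta> enc where \<delta>: "is_hpm \<delta>" "enc (C, False, 0, []) = (0 :: nat)"
    "\<And>q a s. q \<in> states \<Longrightarrow> fst (transition N q a s) \<in> states \<Longrightarrow>
      \<delta> (enc q, a, s) = (enc (fst (transition N q a s)), snd (transition N q a s))"
    by (rule finite_control_machine[OF finite_states, of ?W "transition N" "(C, False, 0, [])"]) blast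
  have sim: "hpm_conf \<delta> e t = (enc (fst (mconf N C e t)), snd (mconf N C e t))" for e t
  proof (induction t)
    case 0
    then show ?case using \<delta>(2) by simp
  next
    case (Suc t)
    obtain q w wh rh \<Gamma> where cfg: "mconf N C e t = (q, w, wh, rh, \<Gamma>)" by (metis prod.collapse)
    let ?rt = "enc_run (\<Gamma> @ map (Pair PB) (e t))"
    let ?tr = "transition N q (w wh) (if rh < length ?rt then ?rt ! rh else Blank)"
    have "q \<in> states" using conf_in_states[of e t] by (simp add: cfg)
    moreover have "fst (mconf N C e (Suc t)) = fst ?tr"
      by (simp add: cfg mstep_def Let_def split: prod.split)
    then have "fst ?tr \<in> states" using conf_in_states[of e "Suc t"] by simp
    ultimately have "\<delta> (enc q, w wh, if rh < length ?rt then ?rt ! rh else Blank) = (enc (fst ?tr), snd ?tr)"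
      by (rule \<delta>(3))
    then show ?case
      using Suc by (simp add: cfg mstep_def hpm_step_def Let_def del: transition.simps split: prod.split)
  qed
  have "gen_run \<delta> e = (\<lambda>t. run_of (mconf N C e t))" for e
    by (rule ext) (simp add: gen_run_def sim)
  then show ?thesis unfolding valid_def solves_def using \<delta>(1) machine_wins by metis
qed

end

lemma (in cluster_names) winnable_imp_valid:
  assumes "wf_cirq Cd Cc C" "winnable C" shows "valid Cd Cc C"
proof -
  \<comment> \<open>The sum bounds each of its terms; \<open>Suc\<close> secures
    \<open>1 \<le> ?N\<close> when \<open>C\<close> has no clusters.\<close>
  let ?N = "Suc (\<Sum>c\<in>clusters C. length c + 4)"
  have "length c + 4 \<le> ?N" if "c \<in> clusters C" for c
    using member_le_sum[OF that, of "\<lambda>c. length c + 4"] by simp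
  then interpret strategy Cd Cc C ?N
    using assms by unfold_locales auto
  show ?thesis by (rule valid_C)
qed

theorem theorem7p6:
  assumes "Cd \<inter> Cc = {}" and "infinite Cd" and "infinite Cc"
    and "\<forall>c\<in>Cd. decimal_numeral c" and "\<forall>c\<in>Cc. decimal_numeral c"
    and "wf_cirq Cd Cc C"
  shows "valid Cd Cc C \<longleftrightarrow> provable Cd Cc C"
proof -
  interpret cluster_names Cd Cc
    using assms(1,4,5) decimal_numeral_no_dot by unfold_locales auto
  show ?thesis
    using valid_imp_winnable winnable_imp_valid winnable_imp_provable provable_imp_winnable assms(1,3,6)
    by blast
qed

end
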